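(* Let $d\ge3$, $p>2^*=\frac{2d}{d-2}$ and $\omega>0$ be fixed. Then $$\varepsilon^{d-1}\hat{\mathcal J}_{\mathbb V^d_\varepsilon}(\omega)\to0\quad\text{as }\varepsilon\to0,$$ and, for every choice, for each $\varepsilon>0$, of a positive ground state $u_\varepsilon$ of $\hat J_{\omega,\mathbb V^d_\varepsilon}$ in $\hat{\mathcal N}_{\omega,\mathbb V^d_\varepsilon}$, $$\hat{\mathcal A}u_\varepsilon\to0\quad\text{in }H^1(\mathbb R^d)\text{ as }\varepsilon\to0 .$$
   Context: Lattice graph: for $\varepsilon>0$, $\mathbb V^d_\varepsilon=\varepsilon\mathbb Z^d$, and $x\sim y$ iff $\sum_{i=1}^d|x_i-y_i|=\varepsilon$. $\|u\|_{\ell^q(\mathbb V^d_\varepsilon)}$ is the usual $\ell^q$ norm with respect to counting measure, and $$\|\nabla^d_\varepsilon u\|^2_{\ell^2(\mathbb V^d_\varepsilon)}=\frac1{2\varepsilon}\sum_{x\in\mathbb V^d_\varepsilon}\sum_{y\sim x}|u(y)-u(x)|^2 .$$ $H^1(\mathbb V^d_\varepsilon)$ is the completion of the finitely supported real functions under the norm $(\|\nabla^d_\varepsilon u\|_{\ell^2}^2+\|u\|_{\ell^2}^2)^{1/2}$. Action on the lattice: $\hat J_{\omega,\mathbb V^d_\varepsilon}(u)=\frac12\|\nabla^d_\varepsilon u\|_{\ell^2}^2+\frac{\varepsilon\omega}{2}\|u\|_{\ell^2}^2-\frac{\varepsilon}{p}\|u\|_{\ell^p}^p$ on $H^1(\mathbb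 V^d_\varepsilon)$; $\hat{\mathcal N}_{\omega,\mathbb V^d_\varepsilon}=\{u\in H^1(\mathbb V^d_\varepsilon)\setminus\{0\}:\|\nabla^d_\varepsilon u\|_{\ell^2}^2+\varepsilon\omega\|u\|_{\ell^2}^2=\varepsilon\|u\|_{\ell^p}^p\}$; $\hat{\mathcal J}_{\mathbb V^d_\varepsilon}(\omega)=\inf_{\hat{\mathcal N}_{\omega,\mathbb V^d_\varepsilon}}\hat J_{\omega,\mathbb V^d_\varepsilon}$. A ground state of $\hat J_{\omega,\mathbb V^d_\varepsilon}$ is a $u\in\hat{\mathcal N}_{\omega,\mathbb V^d_\varepsilon}$ attaining this infimum (it is known that ground states exist for all $\omega,\varepsilon>0$, $p>2$, and have constant sign). Extension operator $\hat{\mathcal A}:H^1(\mathbb V^d_\varepsilon)\to H^1(\mathbb R^d)$: $\hat{\mathcal A}f$ is the continuous piecewise-affine interpolation of $f$, i.e. for every $k\in\mathbb Z^d$ and every permutation $\sigma$ of $\{1,\dots,d\}$, $\hat{\mathcal A}f$ is affine on the simplex $\{\varepsilon k+\varepsilon y:\ 1\ge y_{\sigma(1)}\ge\dots\ge y_{\sigma(d)}\ge0\}$ and coincides with $f$ at its vertices. *)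

theory Defs
  imports "HOL-Analysis.Analysis"
begin

section \<open>The lattice and its function spaces\<close>

definition lattice :: "real \<Rightarrow> (real ^ 'n::finite) set" where
  "lattice \<epsilon> = {x. \<forall>i. \<exists>m::int. x $ i = \<epsilon> * of_int m}"

definition nbrs :: "real \<Rightarrow> real ^ 'n::finite \<Rightarrow> (real ^ 'n) set" where
  "nbrs \<epsilon> x = {y \<in> lattice \<epsilon>. (\<Sum>i\<in>UNIV. \<bar>x $ i - y $ i\<bar>) = \<epsilon>}"

text \<open>
  A function on the lattice is represented by its extension by zero to the whole space, so that
  equality of lattice functions is equality in HOL.  The infinite sums below are meaningful only
  when summable; every element of the space \<open>H1_lattice\<close> has all the sums used here summable
  (for exponents \<open>q \<ge> 2\<close>).
\<close>

definition lq_norm :: "real \<Rightarrow> real \<Rightarrow> (real ^ 'n::finite \<Rightarrow> real) \<Rightarrow> real" where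
  "lq_norm \<epsilon> q u = (\<Sum>\<^sub>\<infinity>x\<in>lattice \<epsilon>. \<bar>u x\<bar> powr q) powr (1 / q)"

definition grad_norm :: "real \<Rightarrow> (real ^ 'n::finite \<Rightarrow> real) \<Rightarrow> real" where
  "grad_norm \<epsilon> u =
     sqrt (1 / (2 * \<epsilon>) * (\<Sum>\<^sub>\<infinity>x\<in>lattice \<epsilon>. \<Sum>y\<in>nbrs \<epsilon> x. \<bar>u y - u x\<bar>\<^sup>2))"

definition H1_lattice_norm :: "real \<Rightarrow> (real ^ 'n::finite \<Rightarrow> real) \<Rightarrow> real" where
  "H1_lattice_norm \<epsilon> u = sqrt ((grad_norm \<epsilon> u)\<^sup>2 + (lq_norm \<epsilon> 2 u)\<^sup>2)"

definition finitely_supported :: "real \<Rightarrow> (real ^ 'n::finite \<Rightarrow> real) set" where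
  "finitely_supported \<epsilon> = {v. finite {x. v x \<noteq> 0} \<and> {x. v x \<noteq> 0} \<subseteq> lattice \<epsilon>}"

text \<open>
  The completion of the finitely supported functions, realised as their closure in the complete
  space of all lattice functions of finite norm.
\<close>

definition H1_lattice :: "real \<Rightarrow> (real ^ 'n::finite \<Rightarrow> real) set" where
  "H1_lattice \<epsilon> =
     {u. (\<forall>x. x \<notin> lattice \<epsilon> \<longrightarrow> u x = 0)
       \<and> (\<lambda>x. \<bar>u x\<bar> powr 2) summable_on lattice \<epsilon>
       \<and> (\<lambda>x. \<Sum>y\<in>nbrs \<epsilon> x. \<bar>u y - u x\<bar>\<^sup>2) summable_on lattice \<epsilon>
       \<and> (\<forall>\<delta>>0. \<exists>v\<in>finitely_supported \<epsilon>. H1_lattice_norm \<epsilon> (\<lambda>x. u x - v x) < \<delta>)}"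

section \<open>Action, Nehari manifold and ground states\<close>

definition action :: "real \<Rightarrow> real \<Rightarrow> real \<Rightarrow> (real ^ 'n::finite \<Rightarrow> real) \<Rightarrow> real" where
  "action p \<omega> \<epsilon> u =
     1 / 2 * (grad_norm \<epsilon> u)\<^sup>2 + \<epsilon> * \<omega> / 2 * (lq_norm \<epsilon> 2 u)\<^sup>2
     - \<epsilon> / p * lq_norm \<epsilon> p u powr p"

definition nehari :: "real \<Rightarrow> real \<Rightarrow> real \<Rightarrow> (real ^ 'n::finite \<Rightarrow> real) set" where
  "nehari p \<omega> \<epsilon> =
     {u \<in> H1_lattice \<epsilon>. u \<noteq> (\<lambda>x. 0) \<and>
        (grad_norm \<epsilon> u)\<^sup>2 + \<epsilon> * \<omega> * (lq_norm \<epsilon> 2 u)\<^sup>2 = \<epsilon> * lq_norm \<epsilon> p u powr p}"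

text \<open>The first argument only fixes the dimension, via the index type of the coordinates.\<close>

definition action_level :: "'n::finite itself \<Rightarrow> real \<Rightarrow> real \<Rightarrow> real \<Rightarrow> real" where
  "action_level _ p \<omega> \<epsilon> =
     (INF u \<in> (nehari p \<omega> \<epsilon> :: (real ^ 'n \<Rightarrow> real) set). action p \<omega> \<epsilon> u)"

definition ground_state :: "real \<Rightarrow> real \<Rightarrow> real \<Rightarrow> (real ^ 'n::finite \<Rightarrow> real) \<Rightarrow> bool" where
  "ground_state p \<omega> \<epsilon> u \<longleftrightarrow>
     u \<in> nehari p \<omega> \<epsilon> \<and> action p \<omega> \<epsilon> u = action_level TYPE('n) p \<omega> \<epsilon>"

section \<open>Piecewise-affine interpolation\<close>

text \<open>
  Permutations of the coordinates are encoded as bijections from \<open>{1..d}\<close> onto the index type,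
  which carries no order of its own.
\<close>

definition kuhn_simplex :: "real \<Rightarrow> int ^ 'n::finite \<Rightarrow> (nat \<Rightarrow> 'n) \<Rightarrow> (real ^ 'n) set" where
  "kuhn_simplex \<epsilon> k \<sigma> =
     {\<epsilon> *\<^sub>R (\<chi> i. of_int (k $ i)) + \<epsilon> *\<^sub>R y | y.
        1 \<ge> y $ \<sigma> 1 \<and> (\<forall>j\<in>{1..<CARD('n)}. y $ \<sigma> j \<ge> y $ \<sigma> (Suc j)) \<and> y $ \<sigma> CARD('n) \<ge> 0}"

definition affine_fun_on :: "(real ^ 'n::finite) set \<Rightarrow> (real ^ 'n \<Rightarrow> real) \<Rightarrow> bool" where
  "affine_fun_on S g \<longleftrightarrow> (\<exists>a b. \<forall>x\<in>S. g x = a \<bullet> x + b)"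

definition is_interpolation ::
    "real \<Rightarrow> (real ^ 'n::finite \<Rightarrow> real) \<Rightarrow> (real ^ 'n \<Rightarrow> real) \<Rightarrow> bool" where
  "is_interpolation \<epsilon> f g \<longleftrightarrow>
     continuous_on UNIV g \<and>
     (\<forall>k \<sigma>. bij_betw \<sigma> {1..CARD('n)} UNIV \<longrightarrow>
        affine_fun_on (kuhn_simplex \<epsilon> k \<sigma>) g \<and>
        (\<forall>v. v extreme_point_of kuhn_simplex \<epsilon> k \<sigma> \<longrightarrow> g v = f v))"

definition interpolation :: "real \<Rightarrow> (real ^ 'n::finite \<Rightarrow> real) \<Rightarrow> real ^ 'n \<Rightarrow> real" where
  "interpolation \<epsilon> f = (THE g. is_interpolation \<epsilon> f g)"

section \<open>The Sobolev space on Euclidean space\<close>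

definition partial_deriv :: "'n \<Rightarrow> (real ^ 'n::finite \<Rightarrow> real) \<Rightarrow> real ^ 'n \<Rightarrow> real" where
  "partial_deriv i \<phi> x = frechet_derivative \<phi> (at x) (axis i 1)"

primrec C_k :: "nat \<Rightarrow> (real ^ 'n::finite \<Rightarrow> real) \<Rightarrow> bool" where
  "C_k 0 \<phi> \<longleftrightarrow> continuous_on UNIV \<phi>"
| "C_k (Suc m) \<phi> \<longleftrightarrow> \<phi> differentiable_on UNIV \<and> (\<forall>i. C_k m (partial_deriv i \<phi>))"

definition test_function :: "(real ^ 'n::finite \<Rightarrow> real) \<Rightarrow> bool" where
  "test_function \<phi> \<longleftrightarrow> (\<forall>m. C_k m \<phi>) \<and> compact (closure {x. \<phi> x \<noteq> 0})"

definition L2 :: "(real ^ 'n::finite \<Rightarrow> 'b::euclidean_space) set" where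
  "L2 = {g \<in> borel_measurable lebesgue. integrable lebesgue (\<lambda>x. (norm (g x))\<^sup>2)}"

definition L2_weak_gradients :: "(real ^ 'n::finite \<Rightarrow> real) \<Rightarrow> (real ^ 'n \<Rightarrow> real ^ 'n) set" where
  "L2_weak_gradients g =
     {G \<in> L2. \<forall>\<phi> i. test_function \<phi> \<longrightarrow>
        (LINT x|lebesgue. g x * partial_deriv i \<phi> x) = - (LINT x|lebesgue. G x $ i * \<phi> x)}"

definition H1 :: "(real ^ 'n::finite \<Rightarrow> real) set" where
  "H1 = {g \<in> L2. L2_weak_gradients g \<noteq> {}}"

text \<open>
  Weak gradients are unique up to null sets, so for \<open>g\<close> in \<open>H1\<close> the infimum is taken over a
  single value.
\<close>

definition H1_norm :: "(real ^ 'n::finite \<Rightarrow> real) \<Rightarrow> real" where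
  "H1_norm g =
     (INF G \<in> L2_weak_gradients g.
        sqrt ((LINT x|lebesgue. (norm (G x))\<^sup>2) + (LINT x|lebesgue. (g x)\<^sup>2)))"

end

theory Submission
  imports Defs
begin

text \<open>
  On the Nehari manifold the action is a multiple of the quadratic part of the energy. Testing with a
  multiple of the indicator of a single lattice point bounds the level by a constant times
  \<open>\<epsilon> * \<epsilon> powr (- 2 * p / (p - 2))\<close>; after multiplication by \<open>\<epsilon> ^ (d - 1)\<close> the exponent is
  positive precisely because \<open>p\<close> is supercritical. Hence the scaled energy of the ground states
  vanishes, and it controls the \<open>H1\<close> norm of their interpolations.

  The interpolation is the Choquet integral (Lovasz extension) of the lattice function, which has the
  closed form \<open>\<integral>\<^sub>0\<^sup>1 F \<lfloor>x + s (1, \<dots>, 1)\<rfloor> ds\<close>, without reference to simplices or orderings. It is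
  Lipschitz and has a right derivative along each axis at every point, equal to a difference of \<open>F\<close>
  along a lattice edge near \<open>x\<close>; these right derivatives form a weak gradient.
\<close>

section \<open>Interpolation as an average over diagonal shifts\<close>

text \<open>The obstacle is that \<open>interpolation\<close> is a definite description whose value
  is only piecewise affine: it must be shown well defined, and its classical gradient is missing on
  simplex boundaries. The diagonal average separates these concerns. Orderings of coordinates matter
  only for identifying the average with the interpolation; the analytic estimates use floors alone,
  because the mean of \<lfloor>a + s\<rfloor> over \<open>s\<close> is exactly \<open>a\<close>.
  One-sided derivatives exist at every point, boundaries included, so there is no exceptional null
  set to treat.

  A single point is the natural trial function because concentration on one cell is cheap in the
  supercritical range. A height c balances a quadratic energy of order c^2 / \<epsilon> against
  \<epsilon> c^p, so c^(p - 2) has order \<epsilon>^(-2), and this is the origin of the exponent 2p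
  / (p - 2). Its being smaller than d is a rearrangement of p > 2d / (d - 2).\<close>

definition unit_meas :: "real measure" where
  "unit_meas = restrict_space lborel {0..<1}"

lemma space_unit_meas [simp]: "space unit_meas = {0..<1}"
  by (simp add: unit_meas_def space_restrict_space)

lemma measure_unit_meas: "A \<in> sets borel \<Longrightarrow> measure unit_meas (A \<inter> {0..<1}) = measure lborel (A \<inter> {0..<1})"
  by (simp add: unit_meas_def measure_restrict_space)

lemma emeasure_unit_space: "emeasure unit_meas (space unit_meas) = 1"
  unfolding unit_meas_def by (simp add: emeasure_restrict_space space_restrict_space)

lemma finite_measure_unit_meas: "finite_measure unit_meas"
  by (rule finite_measureI) (simp add: emeasure_unit_space del: space_unit_meas)

lemma measure_unit_space [simp]: "measure unit_meas {0..<1} = 1"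
  using emeasure_unit_space by (simp add: measure_def)

lemma integral_unit_const [simp]: "(LINT s|unit_meas. c) = (c::real)"
  by (simp add: measure_unit_space)

lemma borel_measurable_unit_meas: "f \<in> borel \<rightarrow>\<^sub>M N \<Longrightarrow> f \<in> unit_meas \<rightarrow>\<^sub>M N"
  unfolding unit_meas_def by (simp add: measurable_restrict_space1)

lemma integrable_unit_bounded:
  fixes f :: "real \<Rightarrow> real"
  assumes "f \<in> unit_meas \<rightarrow>\<^sub>M borel" "\<And>s. 0 \<le> s \<Longrightarrow> s < 1 \<Longrightarrow> \<bar>f s\<bar> \<le> B"
  shows "integrable unit_meas f"
proof (rule finite_measure.integrable_const_bound[OF finite_measure_unit_meas])
  show "AE s in unit_meas. norm (f s) \<le> B" using assms(2) by (intro AE_I2) auto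
qed fact

lemma integrable_unit_floor: "integrable unit_meas (\<lambda>s. real_of_int \<lfloor>a + s\<rfloor>)"
proof (rule integrable_unit_bounded)
  show "(\<lambda>s. real_of_int \<lfloor>a + s\<rfloor>) \<in> borel_measurable unit_meas"
    by (rule borel_measurable_unit_meas) measurable
  show "\<bar>real_of_int \<lfloor>a + s\<rfloor>\<bar> \<le> \<bar>a\<bar> + 2" if "0 \<le> s" "s < 1" for s
    using that by linarith
qed

text \<open>With \<open>r\<close> the fractional part of \<open>a\<close>, the floor exceeds
  \<lfloor>a\<rfloor> by one exactly for \<open>s\<close> in \<open>[1 - r, 1)\<close>, an interval
  of length \<open>r\<close>. This exact mean is what makes integrals over \<open>s\<close> linear
  in the point: the Lipschitz bound, the right derivatives and affinity on simplices all rest on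
  it.\<close>

lemma integral_unit_floor: "(LINT s|unit_meas. real_of_int \<lfloor>a + s\<rfloor>) = a"
proof -
  define r where "r = a - \<lfloor>a\<rfloor>"
  have r: "0 \<le> r" "r < 1" unfolding r_def by linarith+
  have eq: "real_of_int \<lfloor>a + s\<rfloor> = \<lfloor>a\<rfloor> + indicat_real {1 - r..} s" if "s \<in> {0..<1}" for s
  proof (cases "s \<ge> 1 - r")
    case True
    then have "\<lfloor>a + s\<rfloor> = \<lfloor>a\<rfloor> + 1" using that r unfolding r_def by (intro floor_unique) auto
    with True show ?thesis by simp
  next
    case False
    then have "\<lfloor>a + s\<rfloor> = \<lfloor>a\<rfloor>" using that r unfolding r_def by (intro floor_unique) (auto, linarith)
    with False show ?thesis by simp
  qed
  have i: "integrable unit_meas (indicator {1 - r..} :: real \<Rightarrow> real)"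
    by (rule integrable_unit_bounded[where B=1])
      (auto intro: borel_measurable_unit_meas simp: indicator_def[abs_def])
  have "(LINT s|unit_meas. real_of_int \<lfloor>a + s\<rfloor>) = (LINT s|unit_meas. \<lfloor>a\<rfloor> + indicat_real {1 - r..} s)"
    using eq by (intro Bochner_Integration.integral_cong) auto
  also have "\<dots> = \<lfloor>a\<rfloor> + (LINT s|unit_meas. indicat_real {1 - r..} s)"
    by (subst Bochner_Integration.integral_add)
      (auto simp: i finite_measure.integrable_const finite_measure_unit_meas measure_unit_space)
  also have "(LINT s|unit_meas. indicat_real {1 - r..} s) = measure unit_meas ({1 - r..} \<inter> {0..<1})"
    by simp
  also have "\<dots> = measure lborel ({1 - r..} \<inter> {0..<1})" by (rule measure_unit_meas) simp
  also have "{1 - r..} \<inter> {0..<1} = {1 - r..<1}" using r by auto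
  also have "measure lborel {1 - r..<1} = r" using r by simp
  finally show ?thesis by (simp add: r_def)
qed

text \<open>At \<open>s = 0\<close> this is the lower corner of the unit cube containing
  \<open>x\<close>. For \<open>0 \<le> s < 1\<close> it rounds up exactly the coordinates whose
  fractional part is at least \<open>1 - s\<close>, so \<open>s\<close> acts as a threshold.\<close>

definition cell :: "real ^ 'n::finite \<Rightarrow> real \<Rightarrow> int ^ 'n" where
  "cell x s = (\<chi> i. \<lfloor>x $ i + s\<rfloor>)"

definition kuhn :: "(int ^ 'n::finite \<Rightarrow> real) \<Rightarrow> real ^ 'n \<Rightarrow> real" where
  "kuhn F x = (LINT s|unit_meas. F (cell x s))"

lemma cell_nth [simp]: "cell x s $ i = \<lfloor>x $ i + s\<rfloor>"
  by (simp add: cell_def)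

text \<open>Preimages of singletons suffice because \<open>int ^ 'n\<close> is countable. The
  discrete sigma-algebra on the target then makes the composition with an arbitrary lattice function
  measurable.\<close>

lemma measurable_floor_vec:
  fixes h :: "'n::finite \<Rightarrow> 'a \<Rightarrow> real"
  assumes [measurable]: "\<And>i. h i \<in> borel_measurable M"
  shows "(\<lambda>y. (\<chi> i. \<lfloor>h i y\<rfloor>) :: int ^ 'n) \<in> M \<rightarrow>\<^sub>M count_space UNIV"
proof (subst measurable_count_space_eq2_countable, intro conjI ballI)
  fix k :: "int ^ 'n"
  have "(\<lambda>y. (\<chi> i. \<lfloor>h i y\<rfloor>) :: int ^ 'n) -` {k} \<inter> space M = {y \<in> space M. \<forall>i\<in>UNIV. \<lfloor>h i y\<rfloor> = k $ i}"
    by (auto simp: vec_eq_iff)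
  also have "\<dots> \<in> sets M" by measurable
  finally show "(\<lambda>y. (\<chi> i. \<lfloor>h i y\<rfloor>) :: int ^ 'n) -` {k} \<inter> space M \<in> sets M" .
qed auto

lemma measurable_cell_shift: "(\<lambda>s. F (cell x s)) \<in> borel_measurable unit_meas"
  unfolding cell_def
  by (intro borel_measurable_unit_meas measurable_compose[OF measurable_floor_vec]) auto

lemma measurable_cell_base: "(\<lambda>x. cell (c *\<^sub>R x) 0) \<in> borel \<rightarrow>\<^sub>M count_space UNIV"
  unfolding cell_def by (intro measurable_floor_vec) simp

lemma integrable_kuhn:
  fixes M :: real
  assumes "\<And>k. \<bar>F k\<bar> \<le> M"
  shows "integrable unit_meas (\<lambda>s. F (cell x s))"
  using assms by (intro integrable_unit_bounded[where B=M] measurable_cell_shift) auto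

text \<open>A shift \<open>0 \<le> s < 1\<close> never carries an integer coordinate to the next
  integer, so the integrand is constant.\<close>

lemma kuhn_lattice:
  assumes "\<And>i. x $ i = of_int (k $ i)"
  shows "kuhn F x = F k"
proof -
  have "cell x s = k" if "s \<in> {0..<1}" for s
    using that assms by (auto simp: vec_eq_iff intro!: floor_unique)
  then have "kuhn F x = (LINT s|unit_meas. F k)"
    unfolding kuhn_def by (intro Bochner_Integration.integral_cong) auto
  then show ?thesis by simp
qed

text \<open>If the cells of \<open>x\<close> and \<open>y\<close> differ at \<open>s\<close>, some
  pair of floors differs by at least 1, so the oscillation \<open>2 * M\<close> of \<open>F\<close>
  is paid for by the sum of floor differences. Each such difference keeps its sign as
  \<open>s\<close> varies, hence its absolute value has mean \<bar>a - b\<bar>.\<close>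

lemma kuhn_lipschitz:
  fixes x y :: "real ^ 'n::finite"
  assumes M: "\<And>k. \<bar>F k\<bar> \<le> M"
  shows "\<bar>kuhn F x - kuhn F y\<bar> \<le> 2 * M * (\<Sum>i\<in>UNIV. \<bar>x $ i - y $ i\<bar>)"
proof -
  have M0: "0 \<le> M" using M[of 0] by linarith
  have int_floor: "integrable unit_meas (\<lambda>s. \<bar>real_of_int \<lfloor>a + s\<rfloor> - of_int \<lfloor>b + s\<rfloor>\<bar>)" for a b
    by (intro integrable_abs Bochner_Integration.integrable_diff integrable_unit_floor)
  have diff_le: "(LINT s|unit_meas. \<bar>real_of_int \<lfloor>a + s\<rfloor> - of_int \<lfloor>b + s\<rfloor>\<bar>) = a - b" if "b \<le> a" for a b
  proof -
    have "(LINT s|unit_meas. \<bar>real_of_int \<lfloor>a + s\<rfloor> - of_int \<lfloor>b + s\<rfloor>\<bar>)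
        = (LINT s|unit_meas. real_of_int \<lfloor>a + s\<rfloor> - of_int \<lfloor>b + s\<rfloor>)"
      using that by (intro Bochner_Integration.integral_cong refl abs_of_nonneg) (simp add: floor_mono)
    then show ?thesis
      by (simp add: Bochner_Integration.integral_diff integrable_unit_floor integral_unit_floor)
  qed
  have diff: "(LINT s|unit_meas. \<bar>real_of_int \<lfloor>a + s\<rfloor> - of_int \<lfloor>b + s\<rfloor>\<bar>) = \<bar>a - b\<bar>" for a b
    using diff_le[of b a] diff_le[of a b] by (cases "b \<le> a") (simp_all add: abs_minus_commute)
  have pt: "\<bar>F (cell x s) - F (cell y s)\<bar>
      \<le> 2 * M * (\<Sum>i\<in>UNIV. \<bar>real_of_int \<lfloor>x $ i + s\<rfloor> - of_int \<lfloor>y $ i + s\<rfloor>\<bar>)" for s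
  proof (cases "cell x s = cell y s")
    case True
    then show ?thesis using M0 by (simp add: sum_nonneg)
  next
    case False
    then obtain i where "\<lfloor>x $ i + s\<rfloor> \<noteq> \<lfloor>y $ i + s\<rfloor>" by (auto simp: vec_eq_iff)
    then have "1 \<le> \<bar>real_of_int \<lfloor>x $ i + s\<rfloor> - of_int \<lfloor>y $ i + s\<rfloor>\<bar>" by linarith
    also have "\<dots> \<le> (\<Sum>i\<in>UNIV. \<bar>real_of_int \<lfloor>x $ i + s\<rfloor> - of_int \<lfloor>y $ i + s\<rfloor>\<bar>)"
      by (rule member_le_sum) auto
    finally have "2 * M * 1 \<le> 2 * M * (\<Sum>i\<in>UNIV. \<bar>real_of_int \<lfloor>x $ i + s\<rfloor> - of_int \<lfloor>y $ i + s\<rfloor>\<bar>)"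
      using M0 by (intro mult_left_mono) auto
    then show ?thesis using M[of "cell x s"] M[of "cell y s"] by linarith
  qed
  have "kuhn F x - kuhn F y = (LINT s|unit_meas. F (cell x s) - F (cell y s))"
    unfolding kuhn_def
    by (rule Bochner_Integration.integral_diff[symmetric]; rule integrable_kuhn[OF M])
  also have "\<bar>\<dots>\<bar> \<le> (LINT s|unit_meas. \<bar>F (cell x s) - F (cell y s)\<bar>)"
    by (rule integral_abs_bound)
  also have "\<dots> \<le> (LINT s|unit_meas. 2 * M * (\<Sum>i\<in>UNIV. \<bar>real_of_int \<lfloor>x $ i + s\<rfloor> - of_int \<lfloor>y $ i + s\<rfloor>\<bar>))"
    by (rule integral_mono)
      (auto intro!: pt integrable_kuhn[OF M] integrable_abs Bochner_Integration.integrable_diff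
        integrable_mult_right Bochner_Integration.integrable_sum int_floor)
  also have "\<dots> = 2 * M * (\<Sum>i\<in>UNIV. \<bar>x $ i - y $ i\<bar>)"
    by (simp add: Bochner_Integration.integral_sum int_floor diff)
  finally show ?thesis .
qed

lemma cell_shift_cases:
  assumes "0 \<le> s" "s < 1"
  shows "cell x s - cell x 0 \<in> {e. \<forall>i. e $ i \<in> {0, 1}}"
proof -
  have "\<lfloor>x $ i + s\<rfloor> - \<lfloor>x $ i\<rfloor> \<in> {0, 1}" for i
    using assms by (simp; linarith)
  then show ?thesis by simp
qed

text \<open>The average sees \<open>F\<close> only at the corners of the cube containing
  \<open>x\<close>. The global bound \<open>M\<close> provides integrability, while \<open>R\<close>
  may depend on \<open>x\<close>; it is later taken as the root of the sum of squares over the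
  corners.\<close>

lemma kuhn_abs_le:
  assumes M: "\<And>k. \<bar>F k\<bar> \<le> M"
    and R: "\<And>e. e \<in> {e. \<forall>i. e $ i \<in> {0, 1}} \<Longrightarrow> \<bar>F (cell x 0 + e)\<bar> \<le> R"
  shows "\<bar>kuhn F x\<bar> \<le> R"
proof -
  have pt: "\<bar>F (cell x s)\<bar> \<le> R" if "s \<in> {0..<1}" for s
    using R[OF cell_shift_cases, of s x] that by simp
  have "\<bar>kuhn F x\<bar> \<le> (LINT s|unit_meas. \<bar>F (cell x s)\<bar>)"
    unfolding kuhn_def by (rule integral_abs_bound)
  also have "\<dots> \<le> (LINT s|unit_meas. R)"
    using pt by (intro integral_mono integrable_abs integrable_kuhn[OF M])
      (auto simp: finite_measure.integrable_const finite_measure_unit_meas)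
  finally show ?thesis by simp
qed

text \<open>Raising coordinate \<open>i\<close> by a small \<open>h\<close> alters the cell only for
  \<open>s\<close> in a half-open interval of length \<open>h\<close> ending where that coordinate
  crosses an integer. For small \<open>h\<close> no other coordinate crosses an integer there, so
  the same lattice edge is traversed for all these \<open>s\<close>, and the average changes by
  exactly \<open>h\<close> times one edge difference.\<close>

lemma kuhn_right_affine:
  fixes x :: "real ^ 'n::finite" and i :: 'n
  assumes M: "\<And>k. \<bar>F k\<bar> \<le> M"
  shows "\<exists>e\<in>{e. \<forall>i. e $ i \<in> {0, 1}}. \<exists>h0>0. \<forall>h. 0 \<le> h \<and> h \<le> h0 \<longrightarrow>
    kuhn F (x + h *\<^sub>R axis i 1)
      = kuhn F x + h * (F (cell x 0 + e + axis i 1) - F (cell x 0 + e))"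
proof -
  \<comment> \<open>Along the shift \<open>s\<close>, coordinate \<open>i\<close> jumps at \<open>t\<close> only, and \<open>z\<close> is the cell just before the jump.\<close>
  define t where "t = \<lfloor>x $ i\<rfloor> + 1 - x $ i"
  have t: "0 < t" "t \<le> 1" unfolding t_def by linarith+
  define z :: "int ^ 'n" where "z = (\<chi> j. \<lceil>x $ j + t\<rceil> - 1)"
  \<comment> \<open>The floor of \<open>x $ j + s\<close> just before \<open>s = t\<close> is
    \<lceil>x $ j + t\<rceil> - 1, also when \<open>x $ j + t\<close> is an integer. The gap is how
    far \<open>s\<close> may recede from \<open>t\<close> before this floor changes.\<close>
  define gap where "gap j = x $ j + t - of_int (\<lceil>x $ j + t\<rceil> - 1)" for j
  have gap: "0 < gap j" for j unfolding gap_def by linarith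
  \<comment> \<open>The entry \<open>t / 2\<close> forces \<open>h0 < t\<close>, which prevents
    coordinate \<open>i\<close> from crossing a second integer before \<open>s\<close> reaches
    1.\<close>
  define h0 where "h0 = Min (insert (t / 2) (range gap))"
  have h0: "0 < h0" unfolding h0_def using t gap by (subst Min_gr_iff) auto
  have h0_t: "h0 < t" using t Min_le[of "insert (t / 2) (range gap)" "t / 2"] unfolding h0_def by simp
  have h0_gap: "h0 \<le> gap j" for j unfolding h0_def by (rule Min_le) auto
  have zi: "z $ i = \<lfloor>x $ i\<rfloor>" unfolding z_def t_def by simp
  \<comment> \<open>The indicator of the interval where the cell changes is written as a difference
    of two floors, so that its integral is read off from the mean of the floor.\<close>
  have main: "F (cell (x + h *\<^sub>R axis i 1) s) - F (cell x s)
      = (of_int \<lfloor>(x $ i + h) + s\<rfloor> - of_int \<lfloor>x $ i + s\<rfloor>) * (F (z + axis i 1) - F z)"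
    if h: "0 \<le> h" "h \<le> h0" and s: "0 \<le> s" "s < 1" for h s
  proof -
    have other: "cell (x + h *\<^sub>R axis i 1) s $ j = cell x s $ j" if "j \<noteq> i" for j
      using that by (simp add: axis_def)
    have ii: "cell (x + h *\<^sub>R axis i 1) s $ i = \<lfloor>(x $ i + h) + s\<rfloor>" by (simp add: axis_def)
    show ?thesis
    proof (cases "\<lfloor>(x $ i + h) + s\<rfloor> = \<lfloor>x $ i + s\<rfloor>")
      case True
      have "cell (x + h *\<^sub>R axis i 1) s = cell x s"
        unfolding vec_eq_iff using other ii True by (metis cell_nth)
      then show ?thesis using True by simp
    next
      case False
      have s_lt: "s < t"
      proof (rule ccontr)
        assume "\<not> s < t"
        then have "\<lfloor>x $ i + s\<rfloor> = \<lfloor>x $ i\<rfloor> + 1" "\<lfloor>(x $ i + h) + s\<rfloor> = \<lfloor>x $ i\<rfloor> + 1"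
          using h s h0_t unfolding t_def by (intro floor_unique; simp; linarith)+
        then show False using False by simp
      qed
      then have f1: "\<lfloor>x $ i + s\<rfloor> = \<lfloor>x $ i\<rfloor>"
        using s unfolding t_def by (intro floor_unique; simp; linarith)
      have s_ge: "t - h \<le> s"
      proof (rule ccontr)
        assume "\<not> t - h \<le> s"
        then have "\<lfloor>(x $ i + h) + s\<rfloor> = \<lfloor>x $ i\<rfloor>"
          using h s unfolding t_def by (intro floor_unique; simp; linarith)
        then show False using False f1 by simp
      qed
      then have f2: "\<lfloor>(x $ i + h) + s\<rfloor> = \<lfloor>x $ i\<rfloor> + 1"
        using h s s_lt h0_t unfolding t_def by (intro floor_unique; simp; linarith)
      have cz: "cell x s = z"
      proof -
        have "\<lfloor>x $ j + s\<rfloor> = \<lceil>x $ j + t\<rceil> - 1" for j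
          using s_ge s_lt h h0_gap[of j] unfolding gap_def by (intro floor_unique; simp; linarith)
        then show ?thesis by (simp add: vec_eq_iff z_def)
      qed
      have "cell (x + h *\<^sub>R axis i 1) s = z + axis i 1"
        unfolding vec_eq_iff
      proof
        fix j
        show "cell (x + h *\<^sub>R axis i 1) s $ j = (z + axis i 1) $ j"
          using other[of j] ii f2 cz zi by (cases "j = i") (simp_all add: axis_def)
      qed
      then show ?thesis using f1 f2 cz by simp
    qed
  qed
  have "kuhn F (x + h *\<^sub>R axis i 1) = kuhn F x + h * (F (z + axis i 1) - F z)"
    if h: "0 \<le> h" "h \<le> h0" for h
  proof -
    have "kuhn F (x + h *\<^sub>R axis i 1) - kuhn F x
        = (LINT s|unit_meas. F (cell (x + h *\<^sub>R axis i 1) s) - F (cell x s))"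
      unfolding kuhn_def
    by (rule Bochner_Integration.integral_diff[symmetric]; rule integrable_kuhn[OF M])
    also have "\<dots> = (LINT s|unit_meas. (of_int \<lfloor>(x $ i + h) + s\<rfloor> - of_int \<lfloor>x $ i + s\<rfloor>) * (F (z + axis i 1) - F z))"
      using main[OF h] by (intro Bochner_Integration.integral_cong) auto
    also have "\<dots> = h * (F (z + axis i 1) - F z)"
      by (simp add: Bochner_Integration.integral_diff integrable_unit_floor integral_unit_floor)
    finally show ?thesis by simp
  qed
  moreover have "z - cell x 0 \<in> {e. \<forall>i. e $ i \<in> {0, 1}}"
  proof -
    have "\<lceil>x $ j + t\<rceil> - 1 - \<lfloor>x $ j\<rfloor> \<in> {0, 1}" for j
      using t by (simp; linarith)
    then show ?thesis by (simp add: z_def)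
  qed
  ultimately show ?thesis
    using h0 by (intro bexI[of _ "z - cell x 0"] exI[of _ h0]) auto
qed

section \<open>Affinity on Kuhn simplices\<close>

definition pt :: "real \<Rightarrow> int ^ 'n::finite \<Rightarrow> real ^ 'n" where
  "pt \<epsilon> k = \<epsilon> *\<^sub>R (\<chi> i. of_int (k $ i))"

lemma pt_nth [simp]: "pt \<epsilon> k $ i = \<epsilon> * of_int (k $ i)"
  by (simp add: pt_def)

definition ordered_along :: "(nat \<Rightarrow> 'n::finite) \<Rightarrow> real ^ 'n \<Rightarrow> bool" where
  "ordered_along \<sigma> y \<longleftrightarrow>
     1 \<ge> y $ \<sigma> 1 \<and> (\<forall>j\<in>{1..<CARD('n)}. y $ \<sigma> j \<ge> y $ \<sigma> (Suc j)) \<and> y $ \<sigma> CARD('n) \<ge> 0"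

lemma kuhn_simplex_iff: "x \<in> kuhn_simplex \<epsilon> k \<sigma> \<longleftrightarrow> (\<exists>y. x = pt \<epsilon> k + \<epsilon> *\<^sub>R y \<and> ordered_along \<sigma> y)"
  by (auto simp: kuhn_simplex_def ordered_along_def pt_def)

lemma ordered_along_antimono:
  fixes y :: "real ^ 'n::finite"
  assumes "ordered_along \<sigma> y" "1 \<le> a" "a \<le> b" "b \<le> CARD('n)"
  shows "y $ \<sigma> b \<le> y $ \<sigma> a"
  using assms(3,4)
proof (induction b rule: dec_induct)
  case (step n)
  then have "y $ \<sigma> (Suc n) \<le> y $ \<sigma> n"
    using assms(1,2) by (auto simp: ordered_along_def)
  with step show ?case by linarith
qed simp

lemma ordered_along_bounds:
  fixes y :: "real ^ 'n::finite"
  assumes \<sigma>: "bij_betw \<sigma> {1..CARD('n)} UNIV" and y: "ordered_along \<sigma> y"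
  shows "0 \<le> y $ i" "y $ i \<le> 1"
proof -
  obtain j where j: "j \<in> {1..CARD('n)}" "i = \<sigma> j"
    using \<sigma> by (metis UNIV_I bij_betw_imp_surj_on imageE)
  show "0 \<le> y $ i" "y $ i \<le> 1"
    using ordered_along_antimono[OF y, of 1 j] ordered_along_antimono[OF y, of j "CARD('n)"] y j
    by (auto simp: ordered_along_def)
qed

text \<open>The simplex is cut out by comparing coordinates with each other and with 0 and 1, and a
  monotone map applied to every coordinate respects such comparisons. This provides the deformations
  that detect points which are not extreme.\<close>

lemma ordered_along_comp:
  fixes y :: "real ^ 'n::finite"
  assumes \<sigma>: "bij_betw \<sigma> {1..CARD('n)} UNIV" and y: "ordered_along \<sigma> y"
    and mono: "\<And>s t. 0 \<le> s \<Longrightarrow> s \<le> t \<Longrightarrow> t \<le> 1 \<Longrightarrow> \<phi> s \<le> \<phi> t" and "\<phi> 0 \<ge> 0" "\<phi> 1 \<le> (1::real)"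
  shows "ordered_along \<sigma> (\<chi> i. \<phi> (y $ i))"
  unfolding ordered_along_def
proof (intro conjI ballI)
  note b = ordered_along_bounds[OF \<sigma> y]
  show "(\<chi> i. \<phi> (y $ i)) $ \<sigma> 1 \<le> 1" using mono[of "y $ \<sigma> 1" 1] b assms(5) by force
  show "0 \<le> (\<chi> i. \<phi> (y $ i)) $ \<sigma> CARD('n)" using mono[of 0 "y $ \<sigma> CARD('n)"] b assms(4) by force
  show "(\<chi> i. \<phi> (y $ i)) $ \<sigma> (Suc j) \<le> (\<chi> i. \<phi> (y $ i)) $ \<sigma> j" if "j \<in> {1..<CARD('n)}" for j
    using y that b mono[of "y $ \<sigma> (Suc j)" "y $ \<sigma> j"] by (auto simp: ordered_along_def)
qed

text \<open>These are the vertices of the unit simplex for the ordering \<open>\<sigma>\<close>,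
  numbered from 0: the empty interval at \<open>j = 0\<close> gives the origin, and when
  \<open>\<sigma>\<close> is bijective on the index range, passing from \<open>j - 1\<close> to
  \<open>j\<close> adds the unit vector of coordinate \<open>\<sigma> j\<close>.\<close>

definition vtx :: "(nat \<Rightarrow> 'n::finite) \<Rightarrow> nat \<Rightarrow> int ^ 'n" where
  "vtx \<sigma> j = (\<chi> i. if i \<in> \<sigma> ` {1..j} then 1 else 0)"

lemma vtx_0 [simp]: "vtx \<sigma> 0 = 0"
  by (simp add: vtx_def vec_eq_iff)

lemma vtx_perm:
  fixes \<sigma> :: "nat \<Rightarrow> 'n::finite"
  assumes \<sigma>: "bij_betw \<sigma> {1..CARD('n)} UNIV" and "j \<in> {1..CARD('n)}" "m \<le> CARD('n)"
  shows "vtx \<sigma> m $ \<sigma> j = (if j \<le> m then 1 else 0)"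
proof -
  have "\<sigma> j \<in> \<sigma> ` {1..m} \<longleftrightarrow> j \<in> {1..m}"
    using \<sigma> assms(2,3) by (intro inj_on_image_mem_iff[of \<sigma> "{1..CARD('n)}"]) (auto simp: bij_betw_def)
  then show ?thesis using assms(2) by (simp add: vtx_def)
qed

lemma ordered_along_vtx:
  fixes \<sigma> :: "nat \<Rightarrow> 'n::finite"
  assumes \<sigma>: "bij_betw \<sigma> {1..CARD('n)} UNIV" and m: "m \<le> CARD('n)"
  shows "ordered_along \<sigma> (pt 1 (vtx \<sigma> m))"
  using m by (auto simp: ordered_along_def vtx_perm[OF \<sigma>] Suc_le_eq)

lemma sum_telescope_from_1:
  fixes G :: "nat \<Rightarrow> real"
  shows "(\<Sum>j=1..J. G j - G (j - 1)) = G J - G 0"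
  by (induction J) auto

text \<open>
  At level \<open>s\<close> the integrand sits at the vertex collecting the coordinates with \<open>y $ i \<ge> 1 - s\<close>,
  which form an initial segment of the ordering.
\<close>

lemma cell_ordered_along:
  fixes \<sigma> :: "nat \<Rightarrow> 'n::finite" and G :: "int ^ 'n \<Rightarrow> real"
  assumes \<sigma>: "bij_betw \<sigma> {1..CARD('n)} UNIV" and y: "ordered_along \<sigma> y" and s: "0 \<le> s" "s < 1"
  shows "G (cell (pt 1 k + y) s)
    = G k + (\<Sum>j=1..CARD('n). of_int \<lfloor>y $ \<sigma> j + s\<rfloor> * (G (k + vtx \<sigma> j) - G (k + vtx \<sigma> (j - 1))))"
proof -
  define S where "S = {j \<in> {1..CARD('n)}. y $ \<sigma> j + s \<ge> 1}"
  \<comment> \<open>\<open>Max\<close> is unspecified on the empty set; the default 0 selects the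
    base vertex when no coordinate is rounded up.\<close>
  define J where "J = (if S = {} then 0 else Max S)"
  have finS: "finite S" by (simp add: S_def)
  have J_le: "J \<le> CARD('n)" using finS Max_in[of S] by (auto simp: J_def S_def)
  have S_eq: "j \<in> S \<longleftrightarrow> j \<le> J" if j: "j \<in> {1..CARD('n)}" for j
  proof
    assume "j \<in> S" then show "j \<le> J" using finS by (auto simp: J_def)
  next
    assume "j \<le> J"
    then have "S \<noteq> {}" using j by (auto simp: J_def split: if_splits)
    then have "J \<in> S" using finS by (simp add: J_def)
    then show "j \<in> S" using ordered_along_antimono[OF y, of j J] j \<open>j \<le> J\<close> by (auto simp: S_def)
  qed
  have fl: "\<lfloor>y $ \<sigma> j + s\<rfloor> = (if j \<le> J then 1 else 0)" if j: "j \<in> {1..CARD('n)}" for j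
  proof -
    note b = ordered_along_bounds[OF \<sigma> y, of "\<sigma> j"]
    show ?thesis
    proof (cases "j \<le> J")
      case True
      then have "y $ \<sigma> j + s \<ge> 1" using S_eq[OF j] by (auto simp: S_def)
      then have "\<lfloor>y $ \<sigma> j + s\<rfloor> = 1" using b s by (intro floor_unique) auto
      with True show ?thesis by simp
    next
      case False
      then have "y $ \<sigma> j + s < 1" using S_eq[OF j] j by (auto simp: S_def)
      then have "\<lfloor>y $ \<sigma> j + s\<rfloor> = 0" using b s by (intro floor_unique) auto
      with False show ?thesis by simp
    qed
  qed
  have "cell (pt 1 k + y) s = k + vtx \<sigma> J"
  proof (subst vec_eq_iff, intro allI)
    fix i
    obtain j where j: "j \<in> {1..CARD('n)}" "i = \<sigma> j"
      using \<sigma> by (metis UNIV_I bij_betw_imp_surj_on imageE)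
    have "\<lfloor>of_int (k $ i) + y $ i + s\<rfloor> = k $ i + \<lfloor>y $ i + s\<rfloor>"
      by linarith
    then show "cell (pt 1 k + y) s $ i = (k + vtx \<sigma> J) $ i"
      using fl[OF j(1)] vtx_perm[OF \<sigma> j(1) J_le] j by simp
  qed
  \<comment> \<open>The integer coefficients are 1 up to \<open>J\<close> and 0 afterwards, so they
    truncate the sum of edge increments, which then telescopes to the value at vertex
    \<open>J\<close>.\<close>
  moreover have "(\<Sum>j=1..CARD('n). of_int \<lfloor>y $ \<sigma> j + s\<rfloor> * (G (k + vtx \<sigma> j) - G (k + vtx \<sigma> (j - 1))))
      = (\<Sum>j=1..J. G (k + vtx \<sigma> j) - G (k + vtx \<sigma> (j - 1)))"
    using J_le by (intro sum.mono_neutral_cong_right) (auto simp: fl)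
  ultimately show ?thesis using sum_telescope_from_1[of "\<lambda>j. G (k + vtx \<sigma> j)" J] by simp
qed

text \<open>In the expansion of the integrand along the edges, only the integer coefficients depend
  on \<open>s\<close>. Their means are the coordinates of \<open>y\<close>, so averaging leaves an
  expression affine in \<open>y\<close>.\<close>

lemma kuhn_ordered_along:
  fixes \<sigma> :: "nat \<Rightarrow> 'n::finite"
  assumes \<sigma>: "bij_betw \<sigma> {1..CARD('n)} UNIV" and y: "ordered_along \<sigma> y"
  shows "kuhn F (pt 1 k + y)
    = F k + (\<Sum>j=1..CARD('n). y $ \<sigma> j * (F (k + vtx \<sigma> j) - F (k + vtx \<sigma> (j - 1))))"
proof -
  have "kuhn F (pt 1 k + y) = (LINT s|unit_meas. F k
      + (\<Sum>j=1..CARD('n). of_int \<lfloor>y $ \<sigma> j + s\<rfloor> * (F (k + vtx \<sigma> j) - F (k + vtx \<sigma> (j - 1)))))"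
    unfolding kuhn_def using cell_ordered_along[OF \<sigma> y]
    by (intro Bochner_Integration.integral_cong) auto
  also have "\<dots> = F k + (\<Sum>j=1..CARD('n). y $ \<sigma> j * (F (k + vtx \<sigma> j) - F (k + vtx \<sigma> (j - 1))))"
    by (subst Bochner_Integration.integral_add)
      (auto intro!: Bochner_Integration.integrable_sum integrable_unit_floor
        simp: finite_measure.integrable_const finite_measure_unit_meas Bochner_Integration.integral_sum
          integrable_unit_floor integral_unit_floor)
  finally show ?thesis .
qed

lemma affine_kuhn:
  fixes \<sigma> :: "nat \<Rightarrow> 'n::finite"
  assumes \<epsilon>: "\<epsilon> > 0" and \<sigma>: "bij_betw \<sigma> {1..CARD('n)} UNIV"
  shows "affine_fun_on (kuhn_simplex \<epsilon> k \<sigma>) (\<lambda>x. kuhn F (x /\<^sub>R \<epsilon>))"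
proof -
  define c where "c j = F (k + vtx \<sigma> j) - F (k + vtx \<sigma> (j - 1))" for j
  define a :: "real ^ 'n" where "a = (\<Sum>j=1..CARD('n). (c j / \<epsilon>) *\<^sub>R axis (\<sigma> j) 1)"
  have a: "a \<bullet> y = (\<Sum>j=1..CARD('n). y $ \<sigma> j * c j) / \<epsilon>" for y
    unfolding a_def
    by (simp add: inner_sum_left inner_axis' sum_divide_distrib mult.commute)
  have "kuhn F (x /\<^sub>R \<epsilon>) = a \<bullet> x + (F k - a \<bullet> pt \<epsilon> k)" if x: "x \<in> kuhn_simplex \<epsilon> k \<sigma>" for x
  proof -
    obtain y where y: "x = pt \<epsilon> k + \<epsilon> *\<^sub>R y" "ordered_along \<sigma> y"
      using x kuhn_simplex_iff by blast
    have "x /\<^sub>R \<epsilon> = pt 1 k + y" using \<epsilon> y by (simp add: vec_eq_iff field_simps)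
    then have "kuhn F (x /\<^sub>R \<epsilon>) = F k + (\<Sum>j=1..CARD('n). y $ \<sigma> j * c j)"
      using kuhn_ordered_along[OF \<sigma> y(2)] by (simp add: c_def)
    also have "(\<Sum>j=1..CARD('n). y $ \<sigma> j * c j) = a \<bullet> (\<epsilon> *\<^sub>R y)" using \<epsilon> by (simp add: a)
    finally show ?thesis by (simp add: y inner_add_right)
  qed
  then show ?thesis unfolding affine_fun_on_def by blast
qed

text \<open>A point with a coordinate strictly between 0 and 1 is the midpoint of two distinct
  points of the simplex. This inclusion serves existence: the interpolation condition ranges over
  all extreme points, while the average is known to agree with \<open>f\<close> only at lattice
  points.\<close>

lemma extreme_point_kuhn_simplex:
  fixes \<sigma> :: "nat \<Rightarrow> 'n::finite"
  assumes \<epsilon>: "\<epsilon> > 0" and \<sigma>: "bij_betw \<sigma> {1..CARD('n)} UNIV"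
    and v: "v extreme_point_of kuhn_simplex \<epsilon> k \<sigma>"
  shows "\<exists>m. v = pt \<epsilon> m"
proof -
  obtain y where y: "v = pt \<epsilon> k + \<epsilon> *\<^sub>R y" "ordered_along \<sigma> y"
    using v kuhn_simplex_iff unfolding extreme_point_of_def by blast
  note b = ordered_along_bounds[OF \<sigma> y(2)]
  \<comment> \<open>The monotone maps \<open>t\<^sup>2\<close> and \<open>1 - (1 - t)\<^sup>2\<close> preserve the simplex and average to \<open>t\<close>.\<close>
  define y1 :: "real ^ 'n" where "y1 = (\<chi> i. (y $ i)\<^sup>2)"
  define y2 :: "real ^ 'n" where "y2 = (\<chi> i. 1 - (1 - y $ i)\<^sup>2)"
  have "ordered_along \<sigma> y1" unfolding y1_def
    by (rule ordered_along_comp[OF \<sigma> y(2)]) (auto intro: power_mono)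
  moreover have "ordered_along \<sigma> y2" unfolding y2_def
    by (rule ordered_along_comp[OF \<sigma> y(2)]) (auto intro: power_mono)
  ultimately have mem: "pt \<epsilon> k + \<epsilon> *\<^sub>R y1 \<in> kuhn_simplex \<epsilon> k \<sigma>" "pt \<epsilon> k + \<epsilon> *\<^sub>R y2 \<in> kuhn_simplex \<epsilon> k \<sigma>"
    unfolding kuhn_simplex_iff by blast+
  have mid: "v = (1 - 1 / 2) *\<^sub>R (pt \<epsilon> k + \<epsilon> *\<^sub>R y1) + (1 / 2) *\<^sub>R (pt \<epsilon> k + \<epsilon> *\<^sub>R y2)"
    unfolding y(1) y1_def y2_def by (simp add: vec_eq_iff power2_eq_square algebra_simps)
  have "pt \<epsilon> k + \<epsilon> *\<^sub>R y1 = pt \<epsilon> k + \<epsilon> *\<^sub>R y2"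
  proof (rule ccontr)
    assume "pt \<epsilon> k + \<epsilon> *\<^sub>R y1 \<noteq> pt \<epsilon> k + \<epsilon> *\<^sub>R y2"
    then have "v \<in> open_segment (pt \<epsilon> k + \<epsilon> *\<^sub>R y1) (pt \<epsilon> k + \<epsilon> *\<^sub>R y2)"
      unfolding in_segment using mid by (intro conjI exI[of _ "1/2"]) auto
    then show False using v mem unfolding extreme_point_of_def by blast
  qed
  then have "y1 $ i = y2 $ i" for i using \<epsilon> by simp
  then have sq: "(y $ i)\<^sup>2 = 1 - (1 - y $ i)\<^sup>2" for i by (simp add: y1_def y2_def)
  have "y $ i * y $ i = y $ i" for i
    using sq[of i] unfolding power2_eq_square by (simp add: algebra_simps)
  then have y01: "y $ i = 0 \<or> y $ i = 1" for i by simp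
  have y_floor: "y $ i = of_int \<lfloor>y $ i\<rfloor>" for i
    using y01[of i] by (rule disjE) simp_all
  then have "v = pt \<epsilon> (k + cell y 0)"
    unfolding y(1) vec_eq_iff using y_floor by (simp add: distrib_left)
  then show ?thesis by blast
qed

text \<open>In local coordinates every entry of the vertex is an endpoint of \<open>[0, 1]\<close>,
  and a proper convex combination of numbers in \<open>[0, 1]\<close> reaches an endpoint only if
  both numbers equal it. This inclusion serves uniqueness, where the interpolation values at the
  vertices must be available.\<close>

lemma vtx_extreme_point:
  fixes \<sigma> :: "nat \<Rightarrow> 'n::finite"
  assumes \<epsilon>: "\<epsilon> > 0" and \<sigma>: "bij_betw \<sigma> {1..CARD('n)} UNIV" and m: "m \<le> CARD('n)"
  shows "pt \<epsilon> (k + vtx \<sigma> m) extreme_point_of kuhn_simplex \<epsilon> k \<sigma>"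
  unfolding extreme_point_of_def
proof (intro conjI ballI notI)
  show "pt \<epsilon> (k + vtx \<sigma> m) \<in> kuhn_simplex \<epsilon> k \<sigma>"
    unfolding kuhn_simplex_iff using ordered_along_vtx[OF \<sigma> m]
    by (intro exI[of _ "pt 1 (vtx \<sigma> m)"]) (simp add: vec_eq_iff algebra_simps)
next
  fix a b assume "a \<in> kuhn_simplex \<epsilon> k \<sigma>" "b \<in> kuhn_simplex \<epsilon> k \<sigma>"
  then obtain y w where y: "a = pt \<epsilon> k + \<epsilon> *\<^sub>R y" "ordered_along \<sigma> y"
    and w: "b = pt \<epsilon> k + \<epsilon> *\<^sub>R w" "ordered_along \<sigma> w"
    unfolding kuhn_simplex_iff by blast
  assume "pt \<epsilon> (k + vtx \<sigma> m) \<in> open_segment a b"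
  then obtain u where ab: "a \<noteq> b" and u: "0 < u" "u < 1"
    and eq: "pt \<epsilon> (k + vtx \<sigma> m) = (1 - u) *\<^sub>R a + u *\<^sub>R b"
    unfolding in_segment by blast
  have "y $ i = w $ i" for i
  proof -
    note b1 = ordered_along_bounds[OF \<sigma> y(2), of i] and b2 = ordered_along_bounds[OF \<sigma> w(2), of i]
    have "pt \<epsilon> (k + vtx \<sigma> m) $ i = ((1 - u) *\<^sub>R a + u *\<^sub>R b) $ i" using eq by simp
    then have "\<epsilon> * of_int (vtx \<sigma> m $ i) = \<epsilon> * ((1 - u) * y $ i + u * w $ i)"
      unfolding y(1) w(1) by (simp add: algebra_simps)
    then have e: "of_int (vtx \<sigma> m $ i) = (1 - u) * y $ i + u * w $ i" using \<epsilon> by simp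
    have "vtx \<sigma> m $ i = 0 \<or> vtx \<sigma> m $ i = 1" by (simp add: vtx_def)
    then show ?thesis
    proof
      assume "vtx \<sigma> m $ i = 0"
      then have "(1 - u) * y $ i + u * w $ i = 0" using e by simp
      then have "(1 - u) * y $ i = 0" "u * w $ i = 0"
        using b1 b2 u by (simp_all add: add_nonneg_eq_0_iff)
      then show ?thesis using u by simp
    next
      assume "vtx \<sigma> m $ i = 1"
      then have "(1 - u) * (1 - y $ i) + u * (1 - w $ i) = 0" using e by (simp add: algebra_simps)
      then have "(1 - u) * (1 - y $ i) = 0" "u * (1 - w $ i) = 0"
        using b1 b2 u by (simp_all add: add_nonneg_eq_0_iff)
      then show ?thesis using u by simp
    qed
  qed
  then show False using ab unfolding y(1) w(1) by (simp add: vec_eq_iff)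
qed

section \<open>Existence and uniqueness of the interpolation\<close>

lemma kuhn_continuous:
  fixes F :: "int ^ 'n::finite \<Rightarrow> real"
  assumes M: "\<And>k. \<bar>F k\<bar> \<le> M"
  shows "continuous_on UNIV (kuhn F)"
proof (rule continuous_at_imp_continuous_on, intro ballI)
  fix x :: "real ^ 'n"
  have "((\<lambda>y. 2 * M * (\<Sum>i\<in>UNIV. \<bar>y $ i - x $ i\<bar>)) \<longlongrightarrow> 2 * M * (\<Sum>i\<in>UNIV. \<bar>x $ i - x $ i\<bar>)) (at x)"
    by (intro tendsto_intros)
  then have lim: "((\<lambda>y. 2 * M * (\<Sum>i\<in>UNIV. \<bar>y $ i - x $ i\<bar>)) \<longlongrightarrow> 0) (at x)" by simp
  have "((\<lambda>y. kuhn F y - kuhn F x) \<longlongrightarrow> 0) (at x)"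
  proof (rule Lim_null_comparison[OF _ lim], rule always_eventually, rule allI)
    show "norm (kuhn F y - kuhn F x) \<le> 2 * M * (\<Sum>i\<in>UNIV. \<bar>y $ i - x $ i\<bar>)" for y
      using kuhn_lipschitz[of F M y x] M by simp
  qed
  then show "isCont (kuhn F) x" unfolding isCont_def by (rule LIM_zero_cancel)
qed

lemma is_interpolation_kuhn:
  fixes f :: "real ^ 'n::finite \<Rightarrow> real"
  assumes \<epsilon>: "\<epsilon> > 0" and M: "\<And>k. \<bar>f (pt \<epsilon> k)\<bar> \<le> M"
  shows "is_interpolation \<epsilon> f (\<lambda>x. kuhn (\<lambda>k. f (pt \<epsilon> k)) (x /\<^sub>R \<epsilon>))"
  unfolding is_interpolation_def
proof (intro conjI allI impI)
  let ?F = "\<lambda>k. f (pt \<epsilon> k)"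
  show "continuous_on UNIV (\<lambda>x. kuhn ?F (x /\<^sub>R \<epsilon>))"
    by (rule continuous_on_compose2[OF kuhn_continuous[of ?F, OF M]]) (auto intro!: continuous_intros)
next
  fix k :: "int ^ 'n" and \<sigma> :: "nat \<Rightarrow> 'n" assume \<sigma>: "bij_betw \<sigma> {1..CARD('n)} UNIV"
  show "affine_fun_on (kuhn_simplex \<epsilon> k \<sigma>) (\<lambda>x. kuhn (\<lambda>k. f (pt \<epsilon> k)) (x /\<^sub>R \<epsilon>))"
    by (rule affine_kuhn[OF \<epsilon> \<sigma>])
  fix v assume "v extreme_point_of kuhn_simplex \<epsilon> k \<sigma>"
  then obtain m where v: "v = pt \<epsilon> m" using extreme_point_kuhn_simplex[OF \<epsilon> \<sigma>] by blast
  then show "kuhn (\<lambda>k. f (pt \<epsilon> k)) (v /\<^sub>R \<epsilon>) = f v"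
    using \<epsilon> by (subst kuhn_lattice[where k=m]) auto
qed

lemma ex_kuhn_simplex:
  fixes x :: "real ^ 'n::finite"
  assumes \<epsilon>: "\<epsilon> > 0"
  shows "\<exists>k \<sigma>. bij_betw \<sigma> {1..CARD('n)} UNIV \<and> x \<in> kuhn_simplex \<epsilon> k \<sigma>"
proof -
  define k where "k = cell (x /\<^sub>R \<epsilon>) 0"
  define y where "y = x /\<^sub>R \<epsilon> - pt 1 k"
  have y: "0 \<le> y $ i" "y $ i \<le> 1" for i unfolding y_def k_def by (simp_all, linarith+)
  obtain xs :: "'n list" where xs: "set xs = UNIV" "distinct xs"
    using finite_distinct_list[of "UNIV :: 'n set"] by auto
  \<comment> \<open>Sorting is ascending, so the negated key lists the coordinates of
    \<open>y\<close> in decreasing order.\<close>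
  define ys where "ys = sort_key (\<lambda>i. - (y $ i)) xs"
  have ys: "set ys = UNIV" "distinct ys" "sorted (map (\<lambda>i. - (y $ i)) ys)"
    using xs by (simp_all add: ys_def)
  have len: "length ys = CARD('n)" using distinct_card[OF ys(2)] ys(1) by simp
  \<comment> \<open>List positions start at 0, whereas the permutations of the simplices are indexed
    from 1.\<close>
  define \<sigma> where "\<sigma> j = ys ! (j - 1)" for j
  have "bij_betw ((!) ys) {..<CARD('n)} UNIV"
    by (rule bij_betw_nth) (use ys len in auto)
  moreover have "bij_betw (\<lambda>j. j - 1) {1..CARD('n)} {..<CARD('n)}"
    by (rule bij_betwI[where g=Suc]) auto
  ultimately have "bij_betw ((!) ys \<circ> (\<lambda>j. j - 1)) {1..CARD('n)} UNIV"
    by (rule bij_betw_trans[rotated])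
  then have \<sigma>: "bij_betw \<sigma> {1..CARD('n)} UNIV" by (simp add: \<sigma>_def[abs_def] comp_def)
  have "y $ \<sigma> (Suc j) \<le> y $ \<sigma> j" if "j \<in> {1..<CARD('n)}" for j
    using sorted_nth_mono[OF ys(3), of "j - 1" j] that len by (simp add: \<sigma>_def)
  then have "ordered_along \<sigma> y" using y by (auto simp: ordered_along_def)
  moreover have "x = pt \<epsilon> k + \<epsilon> *\<^sub>R y" using \<epsilon> by (simp add: y_def vec_eq_iff field_simps)
  ultimately show ?thesis using \<sigma> kuhn_simplex_iff by blast
qed

text \<open>On a simplex containing \<open>x\<close>, two interpolations differ by an affine
  function that vanishes at all vertices. Consecutive vertices differ by \<open>\<epsilon>\<close>
  times a unit vector, and each unit vector occurs, so the linear part is zero; the value at one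
  vertex then removes the constant.\<close>

lemma is_interpolation_unique:
  fixes f :: "real ^ 'n::finite \<Rightarrow> real"
  assumes \<epsilon>: "\<epsilon> > 0" and g: "is_interpolation \<epsilon> f g" and h: "is_interpolation \<epsilon> f h"
  shows "g = h"
proof
  fix x :: "real ^ 'n"
  obtain k and \<sigma> :: "nat \<Rightarrow> 'n" where \<sigma>: "bij_betw \<sigma> {1..CARD('n)} UNIV" and x: "x \<in> kuhn_simplex \<epsilon> k \<sigma>"
    using ex_kuhn_simplex[OF \<epsilon>] by blast
  obtain a b where ab: "\<And>z. z \<in> kuhn_simplex \<epsilon> k \<sigma> \<Longrightarrow> g z = a \<bullet> z + b"
    using g \<sigma> unfolding is_interpolation_def affine_fun_on_def by blast
  obtain a' b' where ab': "\<And>z. z \<in> kuhn_simplex \<epsilon> k \<sigma> \<Longrightarrow> h z = a' \<bullet> z + b'"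
    using h \<sigma> unfolding is_interpolation_def affine_fun_on_def by blast
  define d where "d z = (a - a') \<bullet> z + (b - b')" for z
  have dS: "g z - h z = d z" if "z \<in> kuhn_simplex \<epsilon> k \<sigma>" for z
    using ab[OF that] ab'[OF that] by (simp add: d_def inner_diff_left)
  have dv: "d (pt \<epsilon> (k + vtx \<sigma> m)) = 0" if m: "m \<le> CARD('n)" for m
  proof -
    note ex = vtx_extreme_point[OF \<epsilon> \<sigma> m, of k]
    have "g (pt \<epsilon> (k + vtx \<sigma> m)) = h (pt \<epsilon> (k + vtx \<sigma> m))"
      using ex g h \<sigma> unfolding is_interpolation_def by simp
    moreover have "pt \<epsilon> (k + vtx \<sigma> m) \<in> kuhn_simplex \<epsilon> k \<sigma>"
      using ex by (simp add: extreme_point_of_def)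
    ultimately show ?thesis using dS by force
  qed
  have "(a - a') $ i = 0" for i
  proof -
    obtain j where j: "j \<in> {1..CARD('n)}" "i = \<sigma> j"
      using \<sigma> by (metis UNIV_I bij_betw_imp_surj_on imageE)
    then have jm: "j - 1 \<le> CARD('n)" by auto
    have "pt \<epsilon> (k + vtx \<sigma> j) - pt \<epsilon> (k + vtx \<sigma> (j - 1)) = \<epsilon> *\<^sub>R axis i 1"
    proof (subst vec_eq_iff, intro allI)
      fix i'
      obtain j' where j': "j' \<in> {1..CARD('n)}" "i' = \<sigma> j'"
        using \<sigma> by (metis UNIV_I bij_betw_imp_surj_on imageE)
      have "i' = i \<longleftrightarrow> j' = j" 
        unfolding j(2) j'(2) using inj_on_eq_iff[OF bij_betw_imp_inj_on[OF \<sigma>] j'(1) j(1)] .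
      then show "(pt \<epsilon> (k + vtx \<sigma> j) - pt \<epsilon> (k + vtx \<sigma> (j - 1))) $ i' = (\<epsilon> *\<^sub>R axis i 1) $ i'"
        using vtx_perm[OF \<sigma> j'(1), of j] vtx_perm[OF \<sigma> j'(1) jm] j(1) j'(1)
        unfolding j'(2)[symmetric] axis_def
        by (cases j' j rule: linorder_cases) (simp_all add: algebra_simps, linarith)
    qed
    moreover have "d (pt \<epsilon> (k + vtx \<sigma> j)) - d (pt \<epsilon> (k + vtx \<sigma> (j - 1)))
        = (a - a') \<bullet> (pt \<epsilon> (k + vtx \<sigma> j) - pt \<epsilon> (k + vtx \<sigma> (j - 1)))"
      by (simp add: d_def inner_diff_right)
    ultimately have "(a - a') \<bullet> (\<epsilon> *\<^sub>R axis i 1) = 0" using dv[of j] dv[OF jm] j(1) by simp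
    then show ?thesis using \<epsilon> by (simp add: inner_axis)
  qed
  then have "a - a' = 0" by (simp add: vec_eq_iff)
  then have "d x = d (pt \<epsilon> (k + vtx \<sigma> 0))" by (simp add: d_def)
  then show "g x = h x" using dv[of 0] dS[OF x] by simp
qed

lemma interpolation_eq_kuhn:
  assumes "\<epsilon> > 0" and "\<And>k. \<bar>f (pt \<epsilon> k)\<bar> \<le> M"
  shows "interpolation \<epsilon> f = (\<lambda>x. kuhn (\<lambda>k. f (pt \<epsilon> k)) (x /\<^sub>R \<epsilon>))"
  unfolding interpolation_def
  using is_interpolation_kuhn[of \<epsilon> f M] is_interpolation_unique[of \<epsilon> f] assms by (intro the_equality) auto

section \<open>Integrals of lattice functions and weak derivatives\<close>

text \<open>The set is a half-open box, squeezed between the open and the closed box with the same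
  corners, which have equal volume.\<close>

lemma emeasure_cell:
  fixes k :: "int ^ 'n::finite"
  assumes \<epsilon>: "\<epsilon> > 0"
  shows "emeasure lborel {x. cell (x /\<^sub>R \<epsilon>) 0 = k} = ennreal (\<epsilon> ^ CARD('n))"
proof -
  define l where "l = pt \<epsilon> k"
  define u where "u = pt \<epsilon> (k + 1)"
  let ?S = "{x. cell (x /\<^sub>R \<epsilon>) 0 = k}"
  have S: "?S = {x. \<forall>i. l $ i \<le> x $ i \<and> x $ i < u $ i}"
    using \<epsilon> by (auto simp: vec_eq_iff floor_eq_iff l_def u_def field_simps)
  have [measurable]: "?S \<in> sets borel"
    using measurable_sets[OF measurable_cell_base[of "inverse \<epsilon>"], of "{k}"] by (simp add: vimage_def)
  have ul: "(u - l) \<bullet> b = \<epsilon>" if "b \<in> Basis" for b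
    using that by (auto simp: Basis_vec_def inner_axis u_def l_def algebra_simps)
  then have lu: "l \<bullet> b \<le> u \<bullet> b" if "b \<in> Basis" for b
    using that \<epsilon> by (force simp: inner_diff_left)
  have vol: "(\<Prod>b\<in>Basis. (u - l) \<bullet> b) = \<epsilon> ^ CARD('n)" by (simp add: ul)
  have "emeasure lborel (box l u) \<le> emeasure lborel ?S"
    by (rule emeasure_mono) (auto simp: S mem_box_cart less_imp_le)
  moreover have "emeasure lborel ?S \<le> emeasure lborel (cbox l u)"
    by (rule emeasure_mono) (auto simp: S mem_box_cart less_imp_le)
  ultimately show ?thesis using lu by (simp add: vol)
qed

text \<open>Cells of equal volume partition the space, so pushing Lebesgue measure forward to the
  corners gives a multiple of counting measure. This converts integrals of functions constant on
  cells into lattice sums.\<close>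

lemma distr_cell:
  assumes \<epsilon>: "\<epsilon> > 0"
  shows "distr lborel (count_space UNIV) (\<lambda>x :: real ^ 'n::finite. cell (x /\<^sub>R \<epsilon>) 0)
    = scale_measure (ennreal (\<epsilon> ^ CARD('n))) (count_space UNIV)"
proof (rule measure_eqI_countable[where A=UNIV])
  fix k :: "int ^ 'n"
  show "emeasure (distr lborel (count_space UNIV) (\<lambda>x :: real ^ 'n. cell (x /\<^sub>R \<epsilon>) 0)) {k}
      = emeasure (scale_measure (ennreal (\<epsilon> ^ CARD('n))) (count_space UNIV)) {k}"
    using measurable_cell_base[of "inverse \<epsilon>"] emeasure_cell[OF \<epsilon>, of k]
    by (subst emeasure_distr) (simp_all add: vimage_def emeasure_count_space)
qed auto

lemma has_bochner_integral_cell: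
  fixes H :: "int ^ 'n::finite \<Rightarrow> real"
  assumes \<epsilon>: "\<epsilon> > 0" and H: "\<And>k. 0 \<le> H k" "H summable_on UNIV"
  shows "has_bochner_integral lborel (\<lambda>x. H (cell (x /\<^sub>R \<epsilon>) 0)) (\<epsilon> ^ CARD('n) * infsum H UNIV)"
proof (rule has_bochner_integral_nn_integral)
  have meas: "(\<lambda>x :: real ^ 'n. cell (x /\<^sub>R \<epsilon>) 0) \<in> lborel \<rightarrow>\<^sub>M count_space UNIV"
    using measurable_cell_base[of "inverse \<epsilon>"] by simp
  show "(\<lambda>x. H (cell (x /\<^sub>R \<epsilon>) 0)) \<in> borel_measurable lborel"
    by (rule measurable_compose[OF meas]) simp
  show "0 \<le> \<epsilon> ^ CARD('n) * infsum H UNIV" using \<epsilon> H by (simp add: infsum_nonneg)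
  have abs: "Infinite_Set_Sum.abs_summable_on H UNIV"
    using H abs_summable_equivalent[of H UNIV] by simp
  then have int: "integrable (count_space UNIV) H" by (simp add: Infinite_Set_Sum.abs_summable_on_def)
  have "integral\<^sup>L (count_space UNIV) H = infsum H UNIV"
    using infsetsum_infsum[OF abs] by (simp add: infsetsum_def)
  then have nn: "(\<integral>\<^sup>+k. H k \<partial>count_space UNIV) = ennreal (infsum H UNIV)"
    using nn_integral_eq_integral[OF int] H(1) by simp
  have "(\<integral>\<^sup>+x. H (cell (x /\<^sub>R \<epsilon>) 0) \<partial>lborel)
      = (\<integral>\<^sup>+k. H k \<partial>distr lborel (count_space UNIV) (\<lambda>x :: real ^ 'n. cell (x /\<^sub>R \<epsilon>) 0))"
    by (subst nn_integral_distr[OF meas]) simp_all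
  also have "\<dots> = ennreal (\<epsilon> ^ CARD('n)) * ennreal (infsum H UNIV)"
    unfolding distr_cell[OF \<epsilon>] using nn by (simp add: nn_integral_scale_measure)
  also have "\<dots> = ennreal (\<epsilon> ^ CARD('n) * infsum H UNIV)"
    using \<epsilon> H by (simp add: ennreal_mult infsum_nonneg)
  finally show "(\<integral>\<^sup>+x. H (cell (x /\<^sub>R \<epsilon>) 0) \<partial>lborel) = ennreal (\<epsilon> ^ CARD('n) * infsum H UNIV)" .
qed (simp add: H(1))

lemma finite_vec_coords:
  assumes "finite A"
  shows "finite {x :: 'a ^ 'n::finite. \<forall>i. x $ i \<in> A}"
proof (rule finite_imageD[where f=vec_nth])
  show "finite (vec_nth ` {x :: 'a ^ 'n. \<forall>i. x $ i \<in> A})"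
    by (rule finite_subset[of _ "PiE UNIV (\<lambda>_. A)"]) (auto intro!: finite_PiE assms)
qed (auto intro!: inj_onI simp: vec_eq_iff)

section \<open>Test functions and weak derivatives\<close>

lemma test_function_has_derivative:
  assumes "test_function \<phi>"
  shows "(\<phi> has_derivative frechet_derivative \<phi> (at x)) (at x)"
proof -
  have "C_k (Suc 0) \<phi>" using assms unfolding test_function_def by blast
  then have "\<phi> differentiable at x" by (simp add: differentiable_on_def)
  then show ?thesis by (simp add: frechet_derivative_works)
qed

lemma test_function_continuous:
  assumes "test_function \<phi>"
  shows "continuous_on UNIV \<phi>" "continuous_on UNIV (partial_deriv i \<phi>)"
proof -
  have "C_k 0 \<phi>" "C_k (Suc 0) \<phi>" using assms unfolding test_function_def by blast+
  then show "continuous_on UNIV \<phi>" "continuous_on UNIV (partial_deriv i \<phi>)" by simp_all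
qed

lemma test_function_directional:
  assumes "test_function \<phi>"
  shows "((\<lambda>t. \<phi> (x - t *\<^sub>R axis i 1)) has_real_derivative - partial_deriv i \<phi> (x - t *\<^sub>R axis i 1)) (at t)"
proof -
  let ?D = "frechet_derivative \<phi> (at (x - t *\<^sub>R axis i 1))"
  have D: "(\<phi> has_derivative ?D) (at (x - t *\<^sub>R axis i 1))"
    by (rule test_function_has_derivative[OF assms])
  have "((\<lambda>t. x - t *\<^sub>R axis i 1) has_derivative (\<lambda>h. - (h *\<^sub>R axis i 1))) (at t)"
    by (auto intro!: derivative_eq_intros)
  from has_derivative_compose[OF this D]
  have "((\<lambda>t. \<phi> (x - t *\<^sub>R axis i 1)) has_derivative (\<lambda>h. ?D (- (h *\<^sub>R axis i 1)))) (at t)" .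
  moreover have "?D (- (h *\<^sub>R axis i 1)) = - partial_deriv i \<phi> (x - t *\<^sub>R axis i 1) * h" for h
    using has_derivative_linear[OF D] by (simp add: linear_neg linear_cmul partial_deriv_def)
  ultimately show ?thesis unfolding has_field_derivative_def by (simp only:)
qed

lemma test_function_support:
  assumes "test_function \<phi>"
  obtains R where "R > 0" "\<And>x. norm x > R \<Longrightarrow> \<phi> x = 0"
proof -
  have "bounded (closure {x. \<phi> x \<noteq> 0})"
    using assms compact_imp_bounded unfolding test_function_def by blast
  then obtain R where R: "R > 0" "\<And>x. x \<in> closure {x. \<phi> x \<noteq> 0} \<Longrightarrow> norm x \<le> R"
    using bounded_pos by metis
  have "\<phi> x = 0" if "norm x > R" for x
    using R(2)[of x] that closure_subset[of "{x. \<phi> x \<noteq> 0}"] by fastforce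
  with R(1) that show thesis by blast
qed

text \<open>
  Translation invariance moves the difference quotient from \<open>g\<close> to the test function, and
  dominated convergence applies on both sides; no Fubini argument is needed.
\<close>

lemma weak_derivative_of_right_derivative:
  fixes g D :: "real ^ 'n::finite \<Rightarrow> real"
  assumes cont: "continuous_on UNIV g" and bd: "\<And>x. \<bar>g x\<bar> \<le> B"
    and lip: "\<And>x h. 0 \<le> h \<Longrightarrow> \<bar>g (x + h *\<^sub>R axis i 1) - g x\<bar> \<le> L * h"
    and lim: "\<And>x. (\<lambda>n. real (Suc n) * (g (x + (1 / real (Suc n)) *\<^sub>R axis i 1) - g x)) \<longlonglongrightarrow> D x"
    and test: "test_function \<phi>"
  shows "(LINT x|lebesgue. g x * partial_deriv i \<phi> x) = - (LINT x|lebesgue. D x * \<phi> x)"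
proof -
  define e :: "nat \<Rightarrow> real ^ 'n" where "e n = (1 / real (Suc n)) *\<^sub>R axis i 1" for n
  have norm_e: "norm (e n) \<le> 1" for n by (simp add: e_def)
  note c\<phi> = test_function_continuous[OF test]
  obtain R where R: "R > 0" "\<And>x. norm x > R \<Longrightarrow> \<phi> x = 0" using test_function_support[OF test] by blast
  have mg [measurable]: "g \<in> borel_measurable borel" by (rule borel_measurable_continuous_onI[OF cont])
  have m\<phi> [measurable]: "\<phi> \<in> borel_measurable borel" by (rule borel_measurable_continuous_onI[OF c\<phi>(1)])
  have mp [measurable]: "partial_deriv i \<phi> \<in> borel_measurable borel"
    by (rule borel_measurable_continuous_onI[OF c\<phi>(2)])
  have mD [measurable]: "D \<in> borel_measurable borel"
    by (rule borel_measurable_LIMSEQ_real[OF lim]) measurable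
  \<comment> \<open>The shifts \<open>e n\<close> have length at most 1: \<open>\<phi>\<close> and
    its translates vanish outside radius \<open>R + 1\<close>, and the mean value points belonging
    to such \<open>x\<close> lie within radius \<open>R + 2\<close>.\<close>
  have "\<exists>C. \<forall>x\<in>cball 0 (R + 2). norm (\<psi> x) \<le> C" if "continuous_on UNIV \<psi>" for \<psi> :: "real ^ 'n \<Rightarrow> real"
    using compact_imp_bounded[OF compact_continuous_image[OF continuous_on_subset[OF that subset_UNIV] compact_cball]]
    unfolding bounded_iff by auto
  then obtain C1 C2 where C1: "\<And>x. x \<in> cball 0 (R + 2) \<Longrightarrow> \<bar>\<phi> x\<bar> \<le> C1"
    and C2: "\<And>x. x \<in> cball 0 (R + 2) \<Longrightarrow> \<bar>partial_deriv i \<phi> x\<bar> \<le> C2"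
    using c\<phi> by (metis real_norm_def)
  have C0: "0 \<le> C1" "0 \<le> C2" using C1[of 0] C2[of 0] R(1) by force+
  have B0: "0 \<le> B" using bd[of 0] by linarith
  have L0: "0 \<le> L" using lip[of 1 0] by simp
  define ind :: "real ^ 'n \<Rightarrow> real" where "ind = indicator (cball 0 (R + 1))"
  have ind_abs [simp]: "\<bar>ind x\<bar> = ind x" for x by (simp add: ind_def)
  have int_ind: "integrable lborel ind"
    unfolding ind_def using emeasure_bounded_finite[of "cball (0 :: real ^ 'n) (R + 1)"] by (intro integrable_real_indicator) auto
  have \<phi>_le: "\<bar>\<phi> x\<bar> \<le> C1 * ind x" for x
    using C1[of x] R(2)[of x] C0 by (cases "norm x \<le> R") (auto simp: ind_def indicator_def)
  have dq_le: "real (Suc n) * \<bar>\<phi> (x - e n) - \<phi> x\<bar> \<le> C2 * ind x" for n x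
  proof (cases "norm x \<le> R + 1")
    case False
    then have "\<phi> x = 0" "\<phi> (x - e n) = 0"
      using R(2) norm_e[of n] norm_triangle_ineq2[of x "e n"] by force+
    then show ?thesis using False by (simp add: ind_def)
  next
    case True
    obtain z where z: "0 < z" "z < 1 / real (Suc n)"
      and eq: "\<phi> (x - (1 / real (Suc n)) *\<^sub>R axis i 1) - \<phi> (x - 0 *\<^sub>R axis i 1)
        = (1 / real (Suc n) - 0) * - partial_deriv i \<phi> (x - z *\<^sub>R axis i 1)"
      using MVT2[of 0 "1 / real (Suc n)" "\<lambda>t. \<phi> (x - t *\<^sub>R axis i 1)" "\<lambda>t. - partial_deriv i \<phi> (x - t *\<^sub>R axis i 1)"]
        test_function_directional[OF test] by auto
    have "1 / real (Suc n) \<le> 1" by simp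
    then have "z \<le> 1" using z(2) by linarith
    then have "norm (z *\<^sub>R axis i 1 :: real ^ 'n) \<le> 1" using z(1) by simp
    then have "x - z *\<^sub>R axis i 1 \<in> cball 0 (R + 2)"
      using True norm_triangle_ineq4[of x "z *\<^sub>R axis i 1"] by simp
    then have "\<bar>partial_deriv i \<phi> (x - z *\<^sub>R axis i 1)\<bar> \<le> C2" by (rule C2)
    moreover have "\<phi> (x - e n) - \<phi> x = - partial_deriv i \<phi> (x - z *\<^sub>R axis i 1) / real (Suc n)"
      using eq by (simp add: e_def del: of_nat_Suc)
    then have "real (Suc n) * \<bar>\<phi> (x - e n) - \<phi> x\<bar> = \<bar>partial_deriv i \<phi> (x - z *\<^sub>R axis i 1)\<bar>"
      by (simp del: of_nat_Suc)
    ultimately show ?thesis using True by (simp add: ind_def)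
  qed
  have dq_lim: "(\<lambda>n. real (Suc n) * (\<phi> (x - e n) - \<phi> x)) \<longlonglongrightarrow> - partial_deriv i \<phi> x" for x
  proof -
    have "((\<lambda>h. (\<phi> (x - (0 + h) *\<^sub>R axis i 1) - \<phi> (x - 0 *\<^sub>R axis i 1)) / h) \<longlongrightarrow> - partial_deriv i \<phi> (x - 0 *\<^sub>R axis i 1)) (at 0)"
      by (rule DERIV_D[OF test_function_directional[OF test]])
    moreover have "filterlim (\<lambda>n. 1 / real (Suc n)) (at 0) sequentially"
      unfolding filterlim_at using LIMSEQ_inverse_real_of_nat
      by (simp add: inverse_eq_divide del: of_nat_Suc)
    ultimately have "(\<lambda>n. (\<phi> (x - (0 + 1 / real (Suc n)) *\<^sub>R axis i 1) - \<phi> (x - 0 *\<^sub>R axis i 1)) / (1 / real (Suc n)))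
        \<longlonglongrightarrow> - partial_deriv i \<phi> (x - 0 *\<^sub>R axis i 1)"
      by (rule filterlim_compose)
    then show ?thesis by (simp add: e_def mult.commute)
  qed
  have int_g: "integrable lborel (\<lambda>x. g (x + a) * \<phi> x)" for a
  proof (rule Bochner_Integration.integrable_bound)
    show "integrable lborel (\<lambda>x. B * C1 * ind x)"
      using int_ind by simp
    show "AE x in lborel. norm (g (x + a) * \<phi> x) \<le> norm (B * C1 * ind x)"
      using mult_mono[OF bd \<phi>_le B0] C0 B0 by (intro AE_I2) (simp add: abs_mult mult.assoc)
  qed measurable
  have transl: "(LINT x|lborel. f (x + a)) = (LINT x|lborel. f x)"
    if [measurable]: "f \<in> borel_measurable borel" for f :: "real ^ 'n \<Rightarrow> real" and a
  proof -
    have "(LINT x|lborel. f x) = (LINT x|distr lborel borel ((+) a). f x)" by (simp add: lborel_distr_plus)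
    also have "\<dots> = (LINT x|lborel. f (a + x))" by (rule integral_distr) auto
    finally show ?thesis by (simp add: add.commute)
  qed
  have int_g': "integrable lborel (\<lambda>x. g x * \<phi> (x - a))" for a
  proof -
    have "integrable lborel (\<lambda>x. g (x + a) * \<phi> (x + a - a))" using int_g[of a] by simp
    then have "integrable (distr lborel borel ((+) a)) (\<lambda>x. g x * \<phi> (x - a))"
      by (subst integrable_distr_eq) (auto simp: add.commute)
    then show ?thesis by (simp add: lborel_distr_plus)
  qed
  have eq: "(LINT x|lborel. real (Suc n) * (g (x + e n) - g x) * \<phi> x)
      = (LINT x|lborel. g x * (real (Suc n) * (\<phi> (x - e n) - \<phi> x)))" for n
  proof -
    have "(LINT x|lborel. real (Suc n) * (g (x + e n) - g x) * \<phi> x)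
        = real (Suc n) * ((LINT x|lborel. g (x + e n) * \<phi> x) - (LINT x|lborel. g x * \<phi> x))"
      using Bochner_Integration.integral_diff[OF int_g[of "e n"] int_g[of 0]]
      by (simp only: Bochner_Integration.integral_mult_right_zero mult.assoc left_diff_distrib add_0_right)
    also have "(LINT x|lborel. g (x + e n) * \<phi> x) = (LINT x|lborel. g x * \<phi> (x - e n))"
      using transl[of "\<lambda>x. g x * \<phi> (x - e n)" "e n"] by simp
    also have "real (Suc n) * ((LINT x|lborel. g x * \<phi> (x - e n)) - (LINT x|lborel. g x * \<phi> x))
        = real (Suc n) * (LINT x|lborel. g x * \<phi> (x - e n) - g x * \<phi> x)"
      using Bochner_Integration.integral_diff[OF int_g'[of "e n"] int_g'[of 0]] by simp
    also have "\<dots> = (LINT x|lborel. real (Suc n) * (g x * \<phi> (x - e n) - g x * \<phi> x))" by simp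
    finally show ?thesis by (simp only: right_diff_distrib mult.left_commute)
  qed
  \<comment> \<open>Here the Lipschitz bound of \<open>g\<close> dominates the quotients; in the
    companion limit the bound on the derivative of \<open>\<phi>\<close> does.\<close>
  have lim1: "(\<lambda>n. LINT x|lborel. real (Suc n) * (g (x + e n) - g x) * \<phi> x) \<longlonglongrightarrow> (LINT x|lborel. D x * \<phi> x)"
  proof (rule integral_dominated_convergence[where w="\<lambda>x. L * C1 * ind x"])
    show "integrable lborel (\<lambda>x. L * C1 * ind x)" using int_ind by simp
    show "AE x in lborel. (\<lambda>n. real (Suc n) * (g (x + e n) - g x) * \<phi> x) \<longlonglongrightarrow> D x * \<phi> x"
      using lim unfolding e_def[symmetric] by (intro AE_I2 tendsto_mult tendsto_const)
    show "AE x in lborel. norm (real (Suc n) * (g (x + e n) - g x) * \<phi> x) \<le> L * C1 * ind x" for n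
    proof (rule AE_I2)
      fix x
      have "\<bar>real (Suc n) * (g (x + e n) - g x)\<bar> \<le> L"
        using lip[of "1 / real (Suc n)" x] unfolding e_def[symmetric]
        by (simp add: abs_mult pos_le_divide_eq mult.commute del: of_nat_Suc)
      from mult_mono[OF this \<phi>_le[of x] L0 abs_ge_zero]
      show "norm (real (Suc n) * (g (x + e n) - g x) * \<phi> x) \<le> L * C1 * ind x"
        unfolding real_norm_def abs_mult[of _ "\<phi> x"] mult.assoc[of L] .
    qed
  qed measurable
  have lim2: "(\<lambda>n. LINT x|lborel. g x * (real (Suc n) * (\<phi> (x - e n) - \<phi> x)))
      \<longlonglongrightarrow> (LINT x|lborel. g x * - partial_deriv i \<phi> x)"
  proof (rule integral_dominated_convergence[where w="\<lambda>x. B * (C2 * ind x)"])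
    show "integrable lborel (\<lambda>x. B * (C2 * ind x))" using int_ind by simp
    show "AE x in lborel. (\<lambda>n. g x * (real (Suc n) * (\<phi> (x - e n) - \<phi> x))) \<longlonglongrightarrow> g x * - partial_deriv i \<phi> x"
      by (intro AE_I2 tendsto_mult tendsto_const dq_lim)
    show "AE x in lborel. norm (g x * (real (Suc n) * (\<phi> (x - e n) - \<phi> x))) \<le> B * (C2 * ind x)" for n
      using mult_mono[OF bd dq_le B0] by (intro AE_I2) (simp add: abs_mult)
  qed measurable
  have "(LINT x|lborel. D x * \<phi> x) = (LINT x|lborel. g x * - partial_deriv i \<phi> x)"
    using LIMSEQ_unique[OF lim1] lim2 unfolding eq by blast
  then show ?thesis by (simp add: integral_completion)
qed

section \<open>Sobolev estimate for the averaged function\<close>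

lemma summable_on_shift:
  fixes H :: "int ^ 'n::finite \<Rightarrow> real"
  shows "(\<lambda>k. H (k + e)) summable_on UNIV \<longleftrightarrow> H summable_on UNIV"
    and "infsum (\<lambda>k. H (k + e)) UNIV = infsum H UNIV"
proof -
  have "bij_betw (\<lambda>k. k + e) UNIV UNIV" by (rule bij_betwI[where g="\<lambda>k. k - e"]) auto
  then show "(\<lambda>k. H (k + e)) summable_on UNIV \<longleftrightarrow> H summable_on UNIV"
    "infsum (\<lambda>k. H (k + e)) UNIV = infsum H UNIV"
    by (rule summable_on_reindex_bij_betw, rule infsum_reindex_bij_betw)
qed

text \<open>Translation invariance of lattice sums makes every corner contribute the same amount.
  Summing over all corners gives a majorant valid whichever corner is relevant at a given point, so
  no measurable selection of corners is involved.\<close>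

lemma has_bochner_integral_cell_corners:
  fixes H :: "int ^ 'n::finite \<Rightarrow> real"
  assumes "\<epsilon> > 0" "\<And>k. 0 \<le> H k" "H summable_on UNIV" "finite E"
  shows "has_bochner_integral lborel (\<lambda>x. \<Sum>e\<in>E. H (cell (x /\<^sub>R \<epsilon>) 0 + e))
    (real (card E) * (\<epsilon> ^ CARD('n) * infsum H UNIV))"
proof -
  have "has_bochner_integral lborel (\<lambda>x. H (cell (x /\<^sub>R \<epsilon>) 0 + e)) (\<epsilon> ^ CARD('n) * infsum H UNIV)" for e
    using has_bochner_integral_cell[of \<epsilon> "\<lambda>k. H (k + e)"] assms by (simp add: summable_on_shift)
  then have "has_bochner_integral lborel (\<lambda>x. \<Sum>e\<in>E. H (cell (x /\<^sub>R \<epsilon>) 0 + e))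
      (\<Sum>e\<in>E. \<epsilon> ^ CARD('n) * infsum H UNIV)"
    by (intro has_bochner_integral_sum)
  then show ?thesis by simp
qed

lemma kuhn_scaled_lipschitz:
  fixes x :: "real ^ 'n::finite"
  assumes \<epsilon>: "\<epsilon> > 0" and M: "\<And>k. \<bar>F k\<bar> \<le> M" and h: "0 \<le> h"
  shows "\<bar>kuhn F ((x + h *\<^sub>R axis i 1) /\<^sub>R \<epsilon>) - kuhn F (x /\<^sub>R \<epsilon>)\<bar> \<le> 2 * M / \<epsilon> * h"
proof -
  have "(\<Sum>j\<in>UNIV. \<bar>((x + h *\<^sub>R axis i 1) /\<^sub>R \<epsilon>) $ j - (x /\<^sub>R \<epsilon>) $ j\<bar>) = (\<Sum>j\<in>UNIV. if j = i then h / \<epsilon> else 0)"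
    using \<epsilon> h by (intro sum.cong refl) (auto simp: axis_def field_simps)
  then show ?thesis
    using kuhn_lipschitz[of F M "(x + h *\<^sub>R axis i 1) /\<^sub>R \<epsilon>" "x /\<^sub>R \<epsilon>"] M by simp
qed

text \<open>Affinity on a short segment makes the difference quotients eventually constant, hence
  convergent at every point. The limit and its form as an edge difference share one existential, so
  that a single choice yields a derivative function with both properties.\<close>

lemma kuhn_right_derivative:
  fixes x :: "real ^ 'n::finite"
  assumes \<epsilon>: "\<epsilon> > 0" and M: "\<And>k. \<bar>F k\<bar> \<le> M"
  shows "\<exists>d. (\<lambda>n. real (Suc n) * (kuhn F ((x + (1 / real (Suc n)) *\<^sub>R axis i 1) /\<^sub>R \<epsilon>) - kuhn F (x /\<^sub>R \<epsilon>))) \<longlonglongrightarrow> d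
    \<and> (\<exists>e\<in>{e. \<forall>i. e $ i \<in> {0, 1}}.
        d = (F (cell (x /\<^sub>R \<epsilon>) 0 + e + axis i 1) - F (cell (x /\<^sub>R \<epsilon>) 0 + e)) / \<epsilon>)"
proof -
  obtain e h0 where e: "e \<in> {e. \<forall>i. e $ i \<in> {0, 1}}" and h0: "h0 > 0"
    and aff: "\<And>h. 0 \<le> h \<and> h \<le> h0 \<Longrightarrow> kuhn F (x /\<^sub>R \<epsilon> + h *\<^sub>R axis i 1)
      = kuhn F (x /\<^sub>R \<epsilon>) + h * (F (cell (x /\<^sub>R \<epsilon>) 0 + e + axis i 1) - F (cell (x /\<^sub>R \<epsilon>) 0 + e))"
    using kuhn_right_affine[of F M "x /\<^sub>R \<epsilon>" i] M by blast
  define d where "d = (F (cell (x /\<^sub>R \<epsilon>) 0 + e + axis i 1) - F (cell (x /\<^sub>R \<epsilon>) 0 + e)) / \<epsilon>"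
  have "eventually (\<lambda>n. 1 / real (Suc n) < \<epsilon> * h0) sequentially"
    using LIMSEQ_Suc[OF lim_1_over_n] h0 \<epsilon> by (intro order_tendstoD(2)[where y=0]) auto
  then have "eventually (\<lambda>n. real (Suc n) * (kuhn F ((x + (1 / real (Suc n)) *\<^sub>R axis i 1) /\<^sub>R \<epsilon>) - kuhn F (x /\<^sub>R \<epsilon>)) = d) sequentially"
  proof eventually_elim
    case (elim n)
    define h where "h = 1 / real (Suc n) / \<epsilon>"
    have "h \<le> h0" unfolding h_def pos_divide_le_eq[OF \<epsilon>]
      using elim by (simp only: mult.commute[of h0] less_imp_le)
    then have h: "0 \<le> h \<and> h \<le> h0" using \<epsilon> by (simp add: h_def)
    have "(x + (1 / real (Suc n)) *\<^sub>R axis i 1) /\<^sub>R \<epsilon> = x /\<^sub>R \<epsilon> + h *\<^sub>R axis i 1"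
      by (simp add: h_def scaleR_add_right divide_inverse mult.commute)
    moreover have "real (Suc n) * h = 1 / \<epsilon>" by (simp add: h_def)
    ultimately show ?case using aff[OF h]
      by (simp only: d_def add_diff_cancel_left' mult.assoc[symmetric]) simp
  qed
  then have "(\<lambda>n. real (Suc n) * (kuhn F ((x + (1 / real (Suc n)) *\<^sub>R axis i 1) /\<^sub>R \<epsilon>) - kuhn F (x /\<^sub>R \<epsilon>))) \<longlonglongrightarrow> d"
    by (rule tendsto_eventually)
  then show ?thesis using e unfolding d_def by blast
qed

text \<open>A single term is dominated by the whole sum. This supplies the uniform bound required
  for averaging a square-summable lattice function.\<close>

lemma abs_le_sqrt_infsum:
  fixes F :: "'a \<Rightarrow> real"
  assumes "(\<lambda>k. (F k)\<^sup>2) summable_on UNIV"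
  shows "\<bar>F k\<bar> \<le> sqrt (\<Sum>\<^sub>\<infinity>k. (F k)\<^sup>2)"
proof -
  have "(\<Sum>\<^sub>\<infinity>k\<in>{k}. (F k)\<^sup>2) \<le> (\<Sum>\<^sub>\<infinity>k. (F k)\<^sup>2)"
    by (rule infsum_mono_neutral) (use assms in auto)
  then show ?thesis by (intro real_le_rsqrt) simp
qed

text \<open>The value at \<open>x\<close> is bounded by corner values, and each right derivative is
  an edge difference starting at one corner. The sums over all corners, \<open>W\<close> and
  \<open>V i\<close>, are therefore majorants constant on cells, and their integrals are lattice
  sums. Since \<open>H1_norm\<close> is an infimum over weak gradients, exhibiting the gradient
  \<open>G\<close> made of right derivatives bounds it from above.\<close>

lemma kuhn_H1:
  fixes F :: "int ^ 'n::finite \<Rightarrow> real"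
  assumes \<epsilon>: "\<epsilon> > 0"
    and sF: "(\<lambda>k. (F k)\<^sup>2) summable_on UNIV"
    and sD: "\<And>i. (\<lambda>k. (F (k + axis i 1) - F k)\<^sup>2) summable_on UNIV"
  defines "g \<equiv> \<lambda>x. kuhn F (x /\<^sub>R \<epsilon>)"
  shows "g \<in> H1" and "0 \<le> H1_norm g"
    and "(H1_norm g)\<^sup>2 \<le> real (card {e :: int ^ 'n. \<forall>i. e $ i \<in> {0, 1}}) * \<epsilon> ^ CARD('n) *
      ((\<Sum>i\<in>UNIV. \<Sum>\<^sub>\<infinity>k. (F (k + axis i 1) - F k)\<^sup>2) / \<epsilon>\<^sup>2 + (\<Sum>\<^sub>\<infinity>k. (F k)\<^sup>2))"
proof -
  define E where "E = {e :: int ^ 'n. \<forall>i. e $ i \<in> {0, 1}}"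
  have finE: "finite E" unfolding E_def by (rule finite_vec_coords) simp
  define c where "c x = cell (x /\<^sub>R \<epsilon>) 0" for x :: "real ^ 'n"
  define M where "M = sqrt (\<Sum>\<^sub>\<infinity>k. (F k)\<^sup>2)"
  have M: "\<bar>F k\<bar> \<le> M" for k unfolding M_def by (rule abs_le_sqrt_infsum[OF sF])
  define W where "W x = (\<Sum>e\<in>E. (F (c x + e))\<^sup>2)" for x
  define V where "V i x = (\<Sum>e\<in>E. (F (c x + e + axis i 1) - F (c x + e))\<^sup>2)" for i x
  have W: "has_bochner_integral lborel W (real (card E) * (\<epsilon> ^ CARD('n) * (\<Sum>\<^sub>\<infinity>k. (F k)\<^sup>2)))"
    using has_bochner_integral_cell_corners[OF \<epsilon> _ sF finE] by (simp add: W_def[abs_def] c_def)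
  have V: "has_bochner_integral lborel (V i) (real (card E) * (\<epsilon> ^ CARD('n) * (\<Sum>\<^sub>\<infinity>k. (F (k + axis i 1) - F k)\<^sup>2)))" for i
    using has_bochner_integral_cell_corners[OF \<epsilon> _ sD[of i] finE] by (simp add: V_def[abs_def] c_def)
  have g_le: "(g x)\<^sup>2 \<le> W x" for x
  proof -
    have "\<bar>g x\<bar> \<le> sqrt (W x)"
      unfolding g_def
    proof (rule kuhn_abs_le[OF M])
      fix e :: "int ^ 'n" assume "e \<in> {e. \<forall>i. e $ i \<in> {0, 1}}"
      then have "(F (c x + e))\<^sup>2 \<le> W x" unfolding W_def using finE by (intro member_le_sum) (auto simp: E_def)
      then show "\<bar>F (cell (x /\<^sub>R \<epsilon>) 0 + e)\<bar> \<le> sqrt (W x)" by (intro real_le_rsqrt) (simp add: c_def)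
    qed
    then show ?thesis using real_sqrt_ge_abs1 by (metis abs_ge_zero power2_abs power_mono real_sqrt_pow2 sum_nonneg W_def zero_le_power2)
  qed
  have g_bd: "\<bar>g x\<bar> \<le> M" for x unfolding g_def by (rule kuhn_abs_le[OF M]) (rule M)
  have cont: "continuous_on UNIV g"
    unfolding g_def
    by (rule continuous_on_compose2[OF kuhn_continuous[of F, OF M]]) (auto intro!: continuous_intros)
  then have mg [measurable]: "g \<in> borel_measurable borel" by (rule borel_measurable_continuous_onI)
  define seq where "seq i n x = real (Suc n) * (g (x + (1 / real (Suc n)) *\<^sub>R axis i 1) - g x)" for i n x
  have "\<exists>d. (\<lambda>n. seq i n x) \<longlonglongrightarrow> d \<and> (\<exists>e\<in>E. d = (F (c x + e + axis i 1) - F (c x + e)) / \<epsilon>)" for i x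
    using kuhn_right_derivative[OF \<epsilon>, of F M x i] M unfolding seq_def g_def c_def E_def by blast
  then obtain D where D: "\<And>i x. (\<lambda>n. seq i n x) \<longlonglongrightarrow> D i x"
    "\<And>i x. \<exists>e\<in>E. D i x = (F (c x + e + axis i 1) - F (c x + e)) / \<epsilon>" by metis
  have mD [measurable]: "D i \<in> borel_measurable borel" for i
    by (rule borel_measurable_LIMSEQ_real[OF D(1)]) (simp add: seq_def)
  have D_le: "(D i x)\<^sup>2 \<le> V i x / \<epsilon>\<^sup>2" for i x
  proof -
    obtain e where e: "e \<in> E" "D i x = (F (c x + e + axis i 1) - F (c x + e)) / \<epsilon>" using D(2) by blast
    have "(F (c x + e + axis i 1) - F (c x + e))\<^sup>2 \<le> V i x"
      unfolding V_def using finE e(1) by (intro member_le_sum) auto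
    then show ?thesis unfolding e(2) power_divide by (rule divide_right_mono) simp
  qed
  define G :: "real ^ 'n \<Rightarrow> real ^ 'n" where "G x = (\<chi> i. D i x)" for x
  have mG [measurable]: "G \<in> borel_measurable borel"
    by (subst borel_measurable_euclidean_space) (auto simp: Basis_vec_def inner_axis G_def)
  have nG: "(norm (G x))\<^sup>2 = (\<Sum>i\<in>UNIV. (D i x)\<^sup>2)" for x
    by (simp add: G_def norm_vec_def L2_set_def sum_nonneg)
  have int_g: "integrable lborel (\<lambda>x. (g x)\<^sup>2)"
  proof (rule Bochner_Integration.integrable_bound)
    show "integrable lborel W" using W by (simp add: has_bochner_integral_iff)
    show "AE x in lborel. norm ((g x)\<^sup>2) \<le> norm (W x)"
      using order_trans[OF g_le abs_ge_self] by (intro AE_I2) simp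
  qed measurable
  have bound_G: "has_bochner_integral lborel (\<lambda>x. \<Sum>i\<in>UNIV. V i x / \<epsilon>\<^sup>2)
      (\<Sum>i\<in>UNIV. real (card E) * (\<epsilon> ^ CARD('n) * (\<Sum>\<^sub>\<infinity>k. (F (k + axis i 1) - F k)\<^sup>2)) / \<epsilon>\<^sup>2)"
    by (intro has_bochner_integral_sum has_bochner_integral_divide_zero V)
  have nG_le: "(norm (G x))\<^sup>2 \<le> (\<Sum>i\<in>UNIV. V i x / \<epsilon>\<^sup>2)" for x
    unfolding nG by (rule sum_mono) (rule D_le)
  have int_G: "integrable lborel (\<lambda>x. (norm (G x))\<^sup>2)"
  proof (rule Bochner_Integration.integrable_bound)
    show "integrable lborel (\<lambda>x. \<Sum>i\<in>UNIV. V i x / \<epsilon>\<^sup>2)"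
      using bound_G unfolding has_bochner_integral_iff by blast
    show "AE x in lborel. norm ((norm (G x))\<^sup>2) \<le> norm (\<Sum>i\<in>UNIV. V i x / \<epsilon>\<^sup>2)"
      using order_trans[OF nG_le abs_ge_self] by (intro AE_I2) simp
  qed measurable
  have L2g: "g \<in> L2" unfolding L2_def using int_g by (simp add: integrable_completion measurable_completion)
  have L2G: "G \<in> L2" unfolding L2_def using int_G by (simp add: integrable_completion measurable_completion)
  have weak: "G \<in> L2_weak_gradients g"
    unfolding L2_weak_gradients_def
  proof (intro CollectI conjI allI impI L2G)
    fix \<phi> :: "real ^ 'n \<Rightarrow> real" and i assume t: "test_function \<phi>"
    have "(LINT x|lebesgue. g x * partial_deriv i \<phi> x) = - (LINT x|lebesgue. D i x * \<phi> x)"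
    proof (rule weak_derivative_of_right_derivative[OF cont g_bd _ _ t])
      show "\<bar>g (x + h *\<^sub>R axis i 1) - g x\<bar> \<le> 2 * M / \<epsilon> * h" if "0 \<le> h" for x h
        unfolding g_def by (rule kuhn_scaled_lipschitz[OF \<epsilon> M that])
      show "(\<lambda>n. real (Suc n) * (g (x + (1 / real (Suc n)) *\<^sub>R axis i 1) - g x)) \<longlonglongrightarrow> D i x" for x
        using D(1)[of i x] by (simp only: seq_def)
    qed
    then show "(LINT x|lebesgue. g x * partial_deriv i \<phi> x) = - (LINT x|lebesgue. G x $ i * \<phi> x)"
      by (simp add: G_def)
  qed
  show "g \<in> H1" unfolding H1_def using L2g weak by blast
  let ?val = "\<lambda>G :: real ^ 'n \<Rightarrow> real ^ 'n. sqrt ((LINT x|lebesgue. (norm (G x))\<^sup>2) + (LINT x|lebesgue. (g x)\<^sup>2))"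
  have nonneg: "0 \<le> ?val G'" for G' by simp
  show H0: "0 \<le> H1_norm g"
    unfolding H1_norm_def using weak nonneg by (intro cINF_greatest) auto
  have "H1_norm g \<le> ?val G"
    unfolding H1_norm_def using nonneg by (intro cINF_lower weak bdd_belowI2[where m=0])
  then have "(H1_norm g)\<^sup>2 \<le> (?val G)\<^sup>2" using H0 by (intro power_mono)
  also have "\<dots> = (LINT x|lborel. (norm (G x))\<^sup>2) + (LINT x|lborel. (g x)\<^sup>2)"
    by (simp add: integral_completion)
  also have "\<dots> \<le> (LINT x|lborel. (\<Sum>i\<in>UNIV. V i x / \<epsilon>\<^sup>2)) + (LINT x|lborel. W x)"
    using int_g int_G bound_G W nG_le g_le
    by (intro add_mono integral_mono) (auto simp: has_bochner_integral_iff)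
  also have "\<dots> = (\<Sum>i\<in>UNIV. real (card E) * (\<epsilon> ^ CARD('n) * (\<Sum>\<^sub>\<infinity>k. (F (k + axis i 1) - F k)\<^sup>2)) / \<epsilon>\<^sup>2)
      + real (card E) * (\<epsilon> ^ CARD('n) * (\<Sum>\<^sub>\<infinity>k. (F k)\<^sup>2))"
    using bound_G W by (simp only: has_bochner_integral_iff)
  also have "\<dots> = real (card E) * \<epsilon> ^ CARD('n) *
      ((\<Sum>i\<in>UNIV. \<Sum>\<^sub>\<infinity>k. (F (k + axis i 1) - F k)\<^sup>2) / \<epsilon>\<^sup>2 + (\<Sum>\<^sub>\<infinity>k. (F k)\<^sup>2))"
    by (simp only: distrib_left sum_distrib_left sum_divide_distrib mult.assoc times_divide_eq_right)
  finally show "(H1_norm g)\<^sup>2 \<le> real (card {e :: int ^ 'n. \<forall>i. e $ i \<in> {0, 1}}) * \<epsilon> ^ CARD('n) *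
      ((\<Sum>i\<in>UNIV. \<Sum>\<^sub>\<infinity>k. (F (k + axis i 1) - F k)\<^sup>2) / \<epsilon>\<^sup>2 + (\<Sum>\<^sub>\<infinity>k. (F k)\<^sup>2))"
    by (simp only: E_def)
qed

section \<open>Energies on the lattice\<close>

lemma lattice_eq_range: "lattice \<epsilon> = range (pt \<epsilon> :: int ^ 'n::finite \<Rightarrow> _)"
proof (intro equalityI subsetI)
  fix x :: "real ^ 'n" assume "x \<in> lattice \<epsilon>"
  then obtain m where "\<And>i. x $ i = \<epsilon> * of_int (m i)" unfolding lattice_def by (auto simp: choice_iff)
  then have "x = pt \<epsilon> (\<chi> i. m i)" by (simp add: vec_eq_iff)
  then show "x \<in> range (pt \<epsilon>)" by blast
qed (auto simp: lattice_def)

lemma inj_pt: "\<epsilon> > 0 \<Longrightarrow> inj (pt \<epsilon>)"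
  by (auto intro!: injI simp: vec_eq_iff)

lemma infsum_lattice:
  fixes H :: "real ^ 'n::finite \<Rightarrow> real"
  assumes "\<epsilon> > 0"
  shows "infsum H (lattice \<epsilon>) = (\<Sum>\<^sub>\<infinity>k. H (pt \<epsilon> k))"
    and "H summable_on lattice \<epsilon> \<longleftrightarrow> (\<lambda>k. H (pt \<epsilon> k)) summable_on UNIV"
  unfolding lattice_eq_range
  using infsum_reindex[OF inj_pt[OF assms], of H] summable_on_reindex[OF inj_pt[OF assms], of H]
  by (simp_all add: o_def)

lemma has_sum_finite_sum:
  fixes f :: "'a \<Rightarrow> 'b \<Rightarrow> real"
  assumes "finite A" "\<And>a. (f a has_sum s a) B"
  shows "((\<lambda>x. \<Sum>a\<in>A. f a x) has_sum (\<Sum>a\<in>A. s a)) B"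
  using assms(1) by (induction A) (auto intro: has_sum_add assms(2))

text \<open>A crude superset of the offsets to neighbours. Only its finiteness, a count independent
  of \<open>\<epsilon>\<close>, and its symmetry under negation enter the estimates.\<close>

definition steps :: "(int ^ 'n::finite) set" where
  "steps = {e. \<forall>i. e $ i \<in> {-1, 0, 1}}"

lemma finite_steps: "finite steps"
  unfolding steps_def by (rule finite_vec_coords) simp

lemma nbrs_subset:
  fixes k :: "int ^ 'n::finite"
  assumes \<epsilon>: "\<epsilon> > 0"
  shows "nbrs \<epsilon> (pt \<epsilon> k) \<subseteq> (\<lambda>e. pt \<epsilon> (k + e)) ` steps"
proof
  fix y :: "real ^ 'n" assume y: "y \<in> nbrs \<epsilon> (pt \<epsilon> k)"
  then obtain m where m: "y = pt \<epsilon> m" unfolding nbrs_def lattice_eq_range by blast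
  have "(m - k) $ i \<in> {-1, 0, 1}" for i
  proof -
    have "\<bar>pt \<epsilon> k $ i - y $ i\<bar> \<le> (\<Sum>i\<in>UNIV. \<bar>pt \<epsilon> k $ i - y $ i\<bar>)"
      by (rule member_le_sum) auto
    also have "\<dots> = \<epsilon>" using y by (simp add: nbrs_def)
    finally have "\<bar>\<epsilon> * (of_int (k $ i) - of_int (m $ i))\<bar> \<le> \<epsilon> * 1"
      unfolding m by (simp add: right_diff_distrib)
    then have "\<bar>of_int (k $ i) - of_int (m $ i) :: real\<bar> \<le> 1"
      using \<epsilon> by (simp only: abs_mult abs_of_pos mult_le_cancel_left_pos)
    then have "\<bar>k $ i - m $ i\<bar> \<le> 1" by linarith
    then show ?thesis by (simp, linarith)
  qed
  then have "m - k \<in> steps" by (simp add: steps_def)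
  then show "y \<in> (\<lambda>e. pt \<epsilon> (k + e)) ` steps" using m by (intro image_eqI[of _ _ "m - k"]) auto
qed

lemma finite_nbrs: "\<epsilon> > 0 \<Longrightarrow> finite (nbrs \<epsilon> (pt \<epsilon> k))"
  using nbrs_subset finite_subset finite_imageI[OF finite_steps] by metis

lemma card_nbrs_le:
  fixes k :: "int ^ 'n::finite"
  shows "\<epsilon> > 0 \<Longrightarrow> card (nbrs \<epsilon> (pt \<epsilon> k)) \<le> card (steps :: (int ^ 'n) set)"
  using surj_card_le[OF finite_steps nbrs_subset] by blast

lemma axis_step_in_nbrs:
  assumes "\<epsilon> > 0"
  shows "pt \<epsilon> (k + axis i 1) \<in> nbrs \<epsilon> (pt \<epsilon> k)"
proof -
  have "(\<Sum>j\<in>UNIV. \<bar>pt \<epsilon> k $ j - pt \<epsilon> (k + axis i 1) $ j\<bar>) = (\<Sum>j\<in>UNIV. if j = i then \<epsilon> else 0)"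
    using assms by (intro sum.cong refl) (auto simp: axis_def algebra_simps)
  then show ?thesis unfolding nbrs_def lattice_eq_range by simp
qed

abbreviation nbr_sum :: "real \<Rightarrow> (real ^ 'n::finite \<Rightarrow> real) \<Rightarrow> real ^ 'n \<Rightarrow> real" where
  "nbr_sum \<epsilon> u x \<equiv> \<Sum>y\<in>nbrs \<epsilon> x. \<bar>u y - u x\<bar>\<^sup>2"

text \<open>The forward neighbours are distinct members of the neighbourhood, and the remaining
  terms are nonnegative. Discarding them costs only a constant after summation, since the neighbour
  sums count each edge from both ends.\<close>

lemma axis_steps_le_nbr_sum:
  fixes k :: "int ^ 'n::finite"
  assumes \<epsilon>: "\<epsilon> > 0"
  shows "(\<Sum>i\<in>UNIV. (u (pt \<epsilon> (k + axis i 1)) - u (pt \<epsilon> k))\<^sup>2) \<le> nbr_sum \<epsilon> u (pt \<epsilon> k)"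
proof -
  have inj: "inj (\<lambda>i. pt \<epsilon> (k + axis i 1))"
  proof (rule injI)
    fix i j assume "pt \<epsilon> (k + axis i 1) = pt \<epsilon> (k + axis j 1)"
    then have "k + axis i 1 = k + axis j 1" by (rule injD[OF inj_pt[OF \<epsilon>]])
    then show "i = j" by (simp add: axis_eq_axis)
  qed
  have "(\<Sum>i\<in>UNIV. (u (pt \<epsilon> (k + axis i 1)) - u (pt \<epsilon> k))\<^sup>2)
      = (\<Sum>y\<in>range (\<lambda>i. pt \<epsilon> (k + axis i 1)). \<bar>u y - u (pt \<epsilon> k)\<bar>\<^sup>2)"
    by (simp add: sum.reindex[OF inj])
  also have "\<dots> \<le> nbr_sum \<epsilon> u (pt \<epsilon> k)"
    by (rule sum_mono2) (auto intro: finite_nbrs[OF \<epsilon>] axis_step_in_nbrs[OF \<epsilon>])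
  finally show ?thesis .
qed

lemma lq_norm_powr:
  assumes "q > 0"
  shows "lq_norm \<epsilon> q u powr q = (\<Sum>\<^sub>\<infinity>x\<in>lattice \<epsilon>. \<bar>u x\<bar> powr q)"
  using assms by (simp add: lq_norm_def powr_powr infsum_nonneg)

lemma lq_norm_2_sq: "(lq_norm \<epsilon> 2 u)\<^sup>2 = (\<Sum>\<^sub>\<infinity>x\<in>lattice \<epsilon>. \<bar>u x\<bar> powr 2)"
proof -
  have "lq_norm \<epsilon> 2 u \<ge> 0" by (simp add: lq_norm_def)
  then have "(lq_norm \<epsilon> 2 u)\<^sup>2 = lq_norm \<epsilon> 2 u powr 2" by simp
  then show ?thesis by (simp only: lq_norm_powr)
qed

lemma grad_norm_sq: "\<epsilon> > 0 \<Longrightarrow> (grad_norm \<epsilon> u)\<^sup>2 = 1 / (2 * \<epsilon>) * infsum (nbr_sum \<epsilon> u) (lattice \<epsilon>)"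
  by (simp add: grad_norm_def infsum_nonneg sum_nonneg)

text \<open>The gradient of the interpolation carries a factor \<open>1 / \<epsilon>\<^sup>2\<close>
  and the cell volume \<open>\<epsilon> ^ CARD('n)\<close>, whereas the squared lattice gradient
  carries \<open>1 / (2 * \<epsilon>)\<close>; together they leave
  \<open>2 * \<epsilon> ^ (CARD('n) - 1)\<close>. This is the same power of
  \<open>\<epsilon>\<close> that scales the action level.\<close>

lemma interpolation_H1_bound:
  fixes u :: "real ^ 'n::finite \<Rightarrow> real"
  assumes \<epsilon>: "\<epsilon> > 0" and u: "u \<in> H1_lattice \<epsilon>"
  shows "interpolation \<epsilon> u \<in> H1" and "0 \<le> H1_norm (interpolation \<epsilon> u)"
    and "(H1_norm (interpolation \<epsilon> u))\<^sup>2 \<le> real (card {e :: int ^ 'n. \<forall>i. e $ i \<in> {0, 1}}) *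
      (2 * \<epsilon> ^ (CARD('n) - 1) * (grad_norm \<epsilon> u)\<^sup>2 + \<epsilon> ^ CARD('n) * (lq_norm \<epsilon> 2 u)\<^sup>2)"
proof -
  define F where "F k = u (pt \<epsilon> k)" for k
  have s2: "(\<lambda>k. (F k)\<^sup>2) summable_on UNIV"
    using u infsum_lattice(2)[OF \<epsilon>, of "\<lambda>x. \<bar>u x\<bar> powr 2"] by (simp add: H1_lattice_def F_def)
  have sN: "(\<lambda>k. nbr_sum \<epsilon> u (pt \<epsilon> k)) summable_on UNIV"
    using u infsum_lattice(2)[OF \<epsilon>, of "nbr_sum \<epsilon> u"] by (simp add: H1_lattice_def)
  have le_N: "(\<Sum>i\<in>UNIV. (F (k + axis i 1) - F k)\<^sup>2) \<le> nbr_sum \<epsilon> u (pt \<epsilon> k)" for k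
    unfolding F_def by (rule axis_steps_le_nbr_sum[OF \<epsilon>])
  have sD: "(\<lambda>k. (F (k + axis i 1) - F k)\<^sup>2) summable_on UNIV" for i
  proof (rule summable_on_comparison_test[OF sN])
    show "(F (k + axis i 1) - F k)\<^sup>2 \<le> nbr_sum \<epsilon> u (pt \<epsilon> k)" for k
      by (rule order_trans[OF member_le_sum le_N]) auto
  qed simp
  define M where "M = sqrt (\<Sum>\<^sub>\<infinity>k. (F k)\<^sup>2)"
  have M: "\<bar>F k\<bar> \<le> M" for k unfolding M_def by (rule abs_le_sqrt_infsum[OF s2])
  have int: "interpolation \<epsilon> u = (\<lambda>x. kuhn F (x /\<^sub>R \<epsilon>))"
    using interpolation_eq_kuhn[OF \<epsilon>, of u M] M unfolding F_def by simp
  note H = kuhn_H1[OF \<epsilon> s2 sD, folded int]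
  show "interpolation \<epsilon> u \<in> H1" "0 \<le> H1_norm (interpolation \<epsilon> u)" by (rule H)+
  have sum_D: "((\<lambda>k. \<Sum>i\<in>UNIV. (F (k + axis i 1) - F k)\<^sup>2) has_sum
      (\<Sum>i\<in>UNIV. \<Sum>\<^sub>\<infinity>k. (F (k + axis i 1) - F k)\<^sup>2)) UNIV"
    by (intro has_sum_finite_sum has_sum_infsum sD) simp
  have "(\<Sum>i\<in>UNIV. \<Sum>\<^sub>\<infinity>k. (F (k + axis i 1) - F k)\<^sup>2) = (\<Sum>\<^sub>\<infinity>k. \<Sum>i\<in>UNIV. (F (k + axis i 1) - F k)\<^sup>2)"
    by (rule infsumI[OF sum_D, symmetric])
  also have "\<dots> \<le> (\<Sum>\<^sub>\<infinity>k. nbr_sum \<epsilon> u (pt \<epsilon> k))"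
    using has_sum_imp_summable[OF sum_D] sN le_N by (intro infsum_mono) auto
  also have "\<dots> = 2 * \<epsilon> * (grad_norm \<epsilon> u)\<^sup>2"
    using \<epsilon> infsum_lattice(1)[OF \<epsilon>, of "nbr_sum \<epsilon> u"] by (simp add: grad_norm_sq)
  finally have grad: "(\<Sum>i\<in>UNIV. \<Sum>\<^sub>\<infinity>k. (F (k + axis i 1) - F k)\<^sup>2) \<le> 2 * \<epsilon> * (grad_norm \<epsilon> u)\<^sup>2" .
  have l2: "(\<Sum>\<^sub>\<infinity>k. (F k)\<^sup>2) = (lq_norm \<epsilon> 2 u)\<^sup>2"
    using infsum_lattice(1)[OF \<epsilon>, of "\<lambda>x. \<bar>u x\<bar> powr 2"] by (simp add: lq_norm_2_sq F_def)
  let ?E = "real (card {e :: int ^ 'n. \<forall>i. e $ i \<in> {0, 1}})"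
  have "(H1_norm (interpolation \<epsilon> u))\<^sup>2
      \<le> ?E * \<epsilon> ^ CARD('n) * ((2 * \<epsilon> * (grad_norm \<epsilon> u)\<^sup>2) / \<epsilon>\<^sup>2 + (lq_norm \<epsilon> 2 u)\<^sup>2)"
    using \<epsilon> by (intro order_trans[OF H(3)] mult_left_mono add_mono divide_right_mono grad) (auto simp: l2)
  also have "\<dots> = ?E * (2 * \<epsilon> ^ (CARD('n) - 1) * (grad_norm \<epsilon> u)\<^sup>2 + \<epsilon> ^ CARD('n) * (lq_norm \<epsilon> 2 u)\<^sup>2)"
  proof -
    have "\<epsilon> ^ CARD('n) = \<epsilon> * \<epsilon> ^ (CARD('n) - 1)" by (simp add: power_eq_if)
    then show ?thesis using \<epsilon> by (simp add: field_simps power2_eq_square)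
  qed
  finally show "(H1_norm (interpolation \<epsilon> u))\<^sup>2
      \<le> ?E * (2 * \<epsilon> ^ (CARD('n) - 1) * (grad_norm \<epsilon> u)\<^sup>2 + \<epsilon> ^ CARD('n) * (lq_norm \<epsilon> 2 u)\<^sup>2)" .
qed

text \<open>The constraint equates the quadratic part with the power term, so either can be
  eliminated. The quadratic form controls the norms of ground states; the power form evaluates the
  trial function and shows the sign of the action for \<open>p > 2\<close>.\<close>

lemma action_nehari:
  assumes "u \<in> nehari p \<omega> \<epsilon>"
  shows "action p \<omega> \<epsilon> u = (1 / 2 - 1 / p) * ((grad_norm \<epsilon> u)\<^sup>2 + \<epsilon> * \<omega> * (lq_norm \<epsilon> 2 u)\<^sup>2)"
    and "action p \<omega> \<epsilon> u = (1 / 2 - 1 / p) * (\<epsilon> * lq_norm \<epsilon> p u powr p)"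
proof -
  have eq: "(grad_norm \<epsilon> u)\<^sup>2 + \<epsilon> * \<omega> * (lq_norm \<epsilon> 2 u)\<^sup>2 = \<epsilon> * lq_norm \<epsilon> p u powr p"
    using assms by (simp add: nehari_def)
  have "action p \<omega> \<epsilon> u = 1 / 2 * ((grad_norm \<epsilon> u)\<^sup>2 + \<epsilon> * \<omega> * (lq_norm \<epsilon> 2 u)\<^sup>2) - 1 / p * (\<epsilon> * lq_norm \<epsilon> p u powr p)"
    by (simp add: action_def algebra_simps)
  then show "action p \<omega> \<epsilon> u = (1 / 2 - 1 / p) * (\<epsilon> * lq_norm \<epsilon> p u powr p)"
    unfolding eq by (simp add: algebra_simps)
  then show "action p \<omega> \<epsilon> u = (1 / 2 - 1 / p) * ((grad_norm \<epsilon> u)\<^sup>2 + \<epsilon> * \<omega> * (lq_norm \<epsilon> 2 u)\<^sup>2)"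
    unfolding eq .
qed

section \<open>Single-site trial functions and bounds for the level\<close>

definition spike :: "real \<Rightarrow> real ^ 'n::finite \<Rightarrow> real" where
  "spike c x = (if x = 0 then c else 0)"

lemma pt_eq_0_iff: "\<epsilon> > 0 \<Longrightarrow> pt \<epsilon> k = 0 \<longleftrightarrow> k = 0"
  by (auto simp: vec_eq_iff)

lemma has_sum_spike:
  assumes "q > 0" "c > 0"
  shows "((\<lambda>x. \<bar>spike c x\<bar> powr q) has_sum c powr q) (lattice \<epsilon> :: (real ^ 'n::finite) set)"
proof -
  have "((\<lambda>x :: real ^ 'n. \<bar>spike c x\<bar> powr q) has_sum (\<Sum>x\<in>{0 :: real ^ 'n}. \<bar>spike c x\<bar> powr q)) {0}"
    by (rule has_sum_finite) simp
  then have "((\<lambda>x :: real ^ 'n. \<bar>spike c x\<bar> powr q) has_sum c powr q) {0}"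
    using assms by (simp add: spike_def)
  moreover have "0 \<in> (lattice \<epsilon> :: (real ^ 'n) set)" unfolding lattice_def by (auto intro: exI[of _ 0])
  ultimately show ?thesis
    by (subst has_sum_cong_neutral[where T="{0}" and g="\<lambda>x. \<bar>spike c x\<bar> powr q"]) (auto simp: spike_def)
qed

text \<open>The neighbour sum can be nonzero only at the origin and its neighbours, all covered by
  \<open>steps\<close>, whose symmetry turns "the origin is a neighbour of \<open>x\<close>" into
  "\<open>x\<close> is a step from the origin". The spike takes only the values 0 and
  \<open>c\<close>, so each squared difference is at most \<open>c\<^sup>2\<close>, and one count of
  \<open>steps\<close> for points and one for neighbours give the square.\<close>

lemma nbr_sum_spike:
  assumes \<epsilon>: "\<epsilon> > 0"
  shows "nbr_sum \<epsilon> (spike c) summable_on (lattice \<epsilon> :: (real ^ 'n::finite) set)"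
    and "infsum (nbr_sum \<epsilon> (spike c)) (lattice \<epsilon> :: (real ^ 'n) set)
      \<le> c\<^sup>2 * real (card (steps :: (int ^ 'n) set)) ^ 2"
proof -
  let ?T = "pt \<epsilon> ` (steps :: (int ^ 'n) set)"
  let ?N = "nbr_sum \<epsilon> (spike c) :: real ^ 'n \<Rightarrow> real"
  have finT: "finite ?T" by (intro finite_imageI finite_steps)
  have sub: "?T \<subseteq> lattice \<epsilon>" unfolding lattice_eq_range by blast
  have zero: "?N x = 0" if x: "x \<in> lattice \<epsilon> - ?T" for x
  proof -
    obtain k where k: "x = pt \<epsilon> k" using x unfolding lattice_eq_range by blast
    have k_ns: "k \<notin> steps" using x k by blast
    have "(0 :: int ^ 'n) \<in> steps" by (simp add: steps_def)
    then have x0: "x \<noteq> 0" using k_ns k pt_eq_0_iff[OF \<epsilon>] by metis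
    have "y \<noteq> 0" if "y \<in> nbrs \<epsilon> x" for y
    proof
      assume "y = 0"
      moreover have "y \<in> (\<lambda>e. pt \<epsilon> (k + e)) ` steps" using that nbrs_subset[OF \<epsilon>, of k] k by auto
      then obtain e where "e \<in> steps" "y = pt \<epsilon> (k + e)" by blast
      ultimately have e: "e \<in> steps" "k + e = 0" using pt_eq_0_iff[OF \<epsilon>] by auto
      then have "k = - e" by (simp add: eq_neg_iff_add_eq_0)
      then have "k \<in> steps" using e(1) by (force simp: steps_def)
      then show False using k_ns by blast
    qed
    then show ?thesis using x0 by (intro sum.neutral) (auto simp: spike_def)
  qed
  have "?N summable_on ?T" using finT by (rule summable_on_finite)
  then show "?N summable_on lattice \<epsilon>"
    using zero sub by (subst summable_on_cong_neutral[where T="?T" and g="?N"]) auto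
  have "infsum ?N (lattice \<epsilon>) = infsum ?N ?T"
    using zero sub by (intro infsum_cong_neutral) auto
  also have "\<dots> = sum ?N ?T" using finT by simp
  also have "\<dots> \<le> (\<Sum>x\<in>?T. c\<^sup>2 * real (card (steps :: (int ^ 'n) set)))"
  proof (rule sum_mono)
    fix x assume "x \<in> ?T"
    then obtain k where k: "x = pt \<epsilon> k" by blast
    have "?N x \<le> (\<Sum>y\<in>nbrs \<epsilon> x. c\<^sup>2)" by (rule sum_mono) (auto simp: spike_def)
    also have "\<dots> = real (card (nbrs \<epsilon> x)) * c\<^sup>2" by simp
    also have "\<dots> \<le> real (card (steps :: (int ^ 'n) set)) * c\<^sup>2"
      using card_nbrs_le[OF \<epsilon>, of k] k by (intro mult_right_mono) auto
    finally show "?N x \<le> c\<^sup>2 * real (card (steps :: (int ^ 'n) set))" by (simp add: mult.commute)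
  qed
  also have "\<dots> = real (card ?T) * (c\<^sup>2 * real (card (steps :: (int ^ 'n) set)))" by simp
  also have "\<dots> \<le> real (card (steps :: (int ^ 'n) set)) * (c\<^sup>2 * real (card (steps :: (int ^ 'n) set)))"
    using card_image_le[OF finite_steps] by (intro mult_right_mono) auto
  finally show "infsum ?N (lattice \<epsilon>) \<le> c\<^sup>2 * real (card (steps :: (int ^ 'n) set)) ^ 2"
    by (simp add: power2_eq_square mult.commute mult.left_commute)
qed

text \<open>Homogeneity isolates the height, leaving a gradient constant independent of
  \<open>c\<close>, so that the Nehari condition can be solved explicitly for
  \<open>c\<close>.\<close>

lemma nbr_sum_spike_scale: "nbr_sum \<epsilon> (spike c) x = c\<^sup>2 * nbr_sum \<epsilon> (spike 1) x"
  unfolding sum_distrib_left by (rule sum.cong) (auto simp: spike_def)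

lemma spike_H1_lattice:
  fixes c :: real
  assumes \<epsilon>: "\<epsilon> > 0" and c: "c > 0"
  shows "(spike c :: real ^ 'n::finite \<Rightarrow> real) \<in> H1_lattice \<epsilon>"
proof -
  have 0: "(0 :: real ^ 'n) \<in> lattice \<epsilon>" unfolding lattice_def by (auto intro: exI[of _ 0])
  have fs: "(spike c :: real ^ 'n \<Rightarrow> real) \<in> finitely_supported \<epsilon>"
    using c 0 by (auto simp: finitely_supported_def spike_def)
  have "H1_lattice_norm \<epsilon> (\<lambda>x :: real ^ 'n. spike c x - spike c x) = 0"
    by (simp add: H1_lattice_norm_def grad_norm_def lq_norm_def)
  then have "\<forall>\<delta>>0. \<exists>v\<in>finitely_supported \<epsilon>. H1_lattice_norm \<epsilon> (\<lambda>x :: real ^ 'n. spike c x - v x) < \<delta>"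
    using fs by force
  moreover have "(\<lambda>x :: real ^ 'n. \<bar>spike c x\<bar> powr 2) summable_on lattice \<epsilon>"
    using has_sum_spike[of 2 c \<epsilon>] c unfolding summable_on_def by auto
  ultimately show ?thesis
    using nbr_sum_spike(1)[OF \<epsilon>, of c] 0 unfolding H1_lattice_def by (auto simp: spike_def)
qed

text \<open>For a spike of height \<open>c\<close> the quadratic part is
  \<open>\<epsilon> * c\<^sup>2 * K\<close> and the power term is
  \<open>\<epsilon> * c powr p\<close>. The Nehari condition thus reads
  \<open>c powr (p - 2) = K\<close>, which dictates the choice of \<open>c\<close>, and the action
  becomes a multiple of \<open>\<epsilon> * K powr (p / (p - 2))\<close>, increasing in the gradient
  constant \<open>S\<close>.\<close>

lemma nehari_spike:
  assumes \<epsilon>: "\<epsilon> > 0" and p: "p > 2" and \<omega>: "\<omega> > 0"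
  shows "\<exists>u \<in> (nehari p \<omega> \<epsilon> :: (real ^ 'n::finite \<Rightarrow> real) set).
    action p \<omega> \<epsilon> u \<le> (1 / 2 - 1 / p) * (\<epsilon> *
      (real (card (steps :: (int ^ 'n) set)) ^ 2 / (2 * \<epsilon>\<^sup>2) + \<omega>) powr (p / (p - 2)))"
proof -
  define S where "S = infsum (nbr_sum \<epsilon> (spike 1)) (lattice \<epsilon> :: (real ^ 'n) set)"
  define K where "K = S / (2 * \<epsilon>\<^sup>2) + \<omega>"
  define c where "c = K powr (1 / (p - 2))"
  have S0: "0 \<le> S" unfolding S_def by (intro infsum_nonneg sum_nonneg) auto
  have S_le: "S \<le> real (card (steps :: (int ^ 'n) set)) ^ 2"
    using nbr_sum_spike(2)[OF \<epsilon>, of 1] by (simp add: S_def)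
  have K: "0 < K" using S0 \<omega> \<epsilon> unfolding K_def by (intro add_nonneg_pos) auto
  then have c: "0 < c" by (simp add: c_def)
  have c_pow: "c powr (p - 2) = K" using p K by (simp add: c_def powr_powr)
  have c_p: "c powr p = K powr (p / (p - 2))" using p by (simp add: c_def powr_powr)
  have c_p': "c powr p = c\<^sup>2 * K"
  proof -
    have "c powr p = c powr (2 + (p - 2))" by simp
    also have "\<dots> = c powr 2 * c powr (p - 2)" by (rule powr_add)
    finally show ?thesis using c c_pow by simp
  qed
  let ?u = "spike c :: real ^ 'n \<Rightarrow> real"
  have lq: "lq_norm \<epsilon> p ?u powr p = c powr p"
    using infsumI[OF has_sum_spike[of p c \<epsilon>]] p c by (simp add: lq_norm_powr)
  have l2: "(lq_norm \<epsilon> 2 ?u)\<^sup>2 = c\<^sup>2"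
    using infsumI[OF has_sum_spike[of 2 c \<epsilon>]] c by (simp add: lq_norm_2_sq)
  have gr: "(grad_norm \<epsilon> ?u)\<^sup>2 = 1 / (2 * \<epsilon>) * (c\<^sup>2 * S)"
    unfolding grad_norm_sq[OF \<epsilon>] nbr_sum_spike_scale[where c=c] S_def by (simp add: infsum_cmult_right')
  have "(grad_norm \<epsilon> ?u)\<^sup>2 + \<epsilon> * \<omega> * (lq_norm \<epsilon> 2 ?u)\<^sup>2 = \<epsilon> * lq_norm \<epsilon> p ?u powr p"
    unfolding lq l2 gr c_p' K_def using \<epsilon> by (simp add: field_simps power2_eq_square)
  moreover have "?u \<noteq> (\<lambda>x. 0)" using c by (auto simp: fun_eq_iff spike_def)
  ultimately have mem: "?u \<in> nehari p \<omega> \<epsilon>"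
    using spike_H1_lattice[OF \<epsilon> c] by (simp add: nehari_def)
  have "action p \<omega> \<epsilon> ?u = (1 / 2 - 1 / p) * (\<epsilon> * K powr (p / (p - 2)))"
    using action_nehari(2)[OF mem] by (simp add: lq c_p)
  also have "\<dots> \<le> (1 / 2 - 1 / p) * (\<epsilon> *
      (real (card (steps :: (int ^ 'n) set)) ^ 2 / (2 * \<epsilon>\<^sup>2) + \<omega>) powr (p / (p - 2)))"
    using p \<epsilon> K S_le unfolding K_def
    by (intro mult_left_mono powr_mono2 add_right_mono divide_right_mono) (auto simp: field_simps)
  finally show ?thesis using mem by blast
qed

text \<open>An infimum of reals is informative only over a nonempty set bounded below: the spike
  supplies a member, and the power form of the action supplies the lower bound 0.\<close>

lemma action_level_bounds:
  assumes \<epsilon>: "\<epsilon> > 0" and p: "p > 2" and \<omega>: "\<omega> > 0"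
  shows "0 \<le> action_level TYPE('n::finite) p \<omega> \<epsilon>"
    and "action_level TYPE('n) p \<omega> \<epsilon> \<le> (1 / 2 - 1 / p) * (\<epsilon> *
      (real (card (steps :: (int ^ 'n) set)) ^ 2 / (2 * \<epsilon>\<^sup>2) + \<omega>) powr (p / (p - 2)))"
proof -
  obtain u :: "real ^ 'n \<Rightarrow> real" where u: "u \<in> nehari p \<omega> \<epsilon>"
    "action p \<omega> \<epsilon> u \<le> (1 / 2 - 1 / p) * (\<epsilon> *
      (real (card (steps :: (int ^ 'n) set)) ^ 2 / (2 * \<epsilon>\<^sup>2) + \<omega>) powr (p / (p - 2)))"
    using nehari_spike[OF assms] by blast
  have nonneg: "0 \<le> action p \<omega> \<epsilon> v" if "v \<in> nehari p \<omega> \<epsilon>" for v :: "real ^ 'n \<Rightarrow> real"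
    unfolding action_nehari(2)[OF that] using p \<epsilon> by (intro mult_nonneg_nonneg) (auto simp: field_simps)
  show "0 \<le> action_level TYPE('n) p \<omega> \<epsilon>"
    unfolding action_level_def using u(1) nonneg by (intro cINF_greatest) auto
  have "action_level TYPE('n) p \<omega> \<epsilon> \<le> action p \<omega> \<epsilon> u"
    unfolding action_level_def using nonneg by (intro cINF_lower u(1) bdd_belowI2[where m=0])
  then show "action_level TYPE('n) p \<omega> \<epsilon> \<le> (1 / 2 - 1 / p) * (\<epsilon> *
      (real (card (steps :: (int ^ 'n) set)) ^ 2 / (2 * \<epsilon>\<^sup>2) + \<omega>) powr (p / (p - 2)))"
    using u(2) by linarith
qed

section \<open>Vanishing of the scaled level and of the interpolations\<close>

lemma supercritical_gt_2:
  fixes p :: real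
  assumes d: "(n :: nat) \<ge> 3" and p: "p > 2 * real n / (real n - 2)"
  shows "p > 2"
proof -
  have "2 * (real n - 2) < 2 * real n" by simp
  also have "\<dots> < p * (real n - 2)" using assms by (simp add: pos_divide_less_eq)
  finally show ?thesis by (rule mult_right_less_imp_less) (use d in simp)
qed

lemma scaled_action_level_tendsto_0:
  fixes p \<omega> :: real
  assumes d: "CARD('n::finite) \<ge> 3"
    and p: "p > 2 * real CARD('n) / (real CARD('n) - 2)"
    and \<omega>: "\<omega> > 0"
  shows "((\<lambda>\<epsilon>. \<epsilon> ^ (CARD('n) - 1) * action_level TYPE('n) p \<omega> \<epsilon>) \<longlongrightarrow> 0) (at_right 0)"
proof -
  define d where "d = real CARD('n)"
  define b where "b = real (card (steps :: (int ^ 'n) set)) ^ 2 / 2"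
  define q where "q = p / (p - 2)"
  define A where "A = (1 / 2 - 1 / p) * (b + \<omega>) powr q"
  have d3: "d \<ge> 3" using d by (simp add: d_def)
  have pd: "2 * d < p * (d - 2)" using p d3 by (simp add: d_def[symmetric] pos_divide_less_eq)
  have p2: "p > 2" by (rule supercritical_gt_2[OF d p])
  \<comment> \<open>Both this and the preceding inequality say \<open>p * d > 2 * p + 2 * d\<close>;
    dividing by \<open>p - 2\<close> turns supercriticality into positivity of the final
    exponent.\<close>
  have "2 * p < d * (p - 2)" using pd by (simp add: algebra_simps)
  then have exponent: "0 < d - 2 * q" using p2 by (simp add: q_def pos_divide_less_eq)
  have b0: "0 \<le> b" by (simp add: b_def)
  have q0: "0 \<le> q" using p2 by (simp add: q_def)
  have bound: "\<epsilon> ^ (CARD('n) - 1) * action_level TYPE('n) p \<omega> \<epsilon> \<le> A * \<epsilon> powr (d - 2 * q)"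
    if \<epsilon>: "0 < \<epsilon>" "\<epsilon> < 1" for \<epsilon>
  proof -
    \<comment> \<open>For \<open>\<epsilon> < 1\<close> the mass term is absorbed into the gradient
      scale, leaving a pure power of \<open>\<epsilon>\<close>.\<close>
    have "\<omega> \<le> \<omega> / \<epsilon>\<^sup>2" using \<omega> \<epsilon> by (simp add: le_divide_eq power_le_one)
    then have "b / \<epsilon>\<^sup>2 + \<omega> \<le> (b + \<omega>) / \<epsilon>\<^sup>2" by (simp add: add_divide_distrib)
    then have "(b / \<epsilon>\<^sup>2 + \<omega>) powr q \<le> ((b + \<omega>) / \<epsilon>\<^sup>2) powr q"
      using b0 \<omega> q0 by (intro powr_mono2) auto
    also have "\<dots> = (b + \<omega>) powr q * \<epsilon> powr (- 2 * q)"
      using b0 \<omega> \<epsilon> by (simp add: powr_divide powr_powr powr_minus_divide flip: powr_numeral)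
    finally have le: "(b / \<epsilon>\<^sup>2 + \<omega>) powr q \<le> (b + \<omega>) powr q * \<epsilon> powr (- 2 * q)" .
    have "\<epsilon> ^ (CARD('n) - 1) * action_level TYPE('n) p \<omega> \<epsilon>
        \<le> \<epsilon> ^ (CARD('n) - 1) * ((1 / 2 - 1 / p) * (\<epsilon> * (b / \<epsilon>\<^sup>2 + \<omega>) powr q))"
      using action_level_bounds(2)[OF \<epsilon>(1) p2 \<omega>, where 'n='n] \<epsilon>
      by (intro mult_left_mono) (auto simp: b_def q_def)
    also have "\<dots> \<le> \<epsilon> ^ (CARD('n) - 1) * ((1 / 2 - 1 / p) * (\<epsilon> * ((b + \<omega>) powr q * \<epsilon> powr (- 2 * q))))"
      using \<epsilon> p2 le by (intro mult_left_mono) (auto simp: field_simps)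
    also have "\<dots> = A * (\<epsilon> ^ CARD('n) * \<epsilon> powr (- 2 * q))"
      by (simp add: A_def power_eq_if)
    also have "\<epsilon> ^ CARD('n) * \<epsilon> powr (- 2 * q) = \<epsilon> powr (d - 2 * q)"
      using \<epsilon> by (simp add: d_def powr_diff powr_realpow powr_minus_divide)
    finally show ?thesis .
  qed
  have "((\<lambda>\<epsilon>. A * \<epsilon> powr (d - 2 * q)) \<longlongrightarrow> A * 0) (at_right 0)"
    using exponent by (intro tendsto_intros tendsto_zero_powrI[where b="d - 2 * q"])
      (auto intro: eventually_mono[OF eventually_at_right_less] tendsto_eq_intros)
  then have lim: "((\<lambda>\<epsilon>. A * \<epsilon> powr (d - 2 * q)) \<longlongrightarrow> 0) (at_right 0)" by simp
  have ev: "eventually (\<lambda>\<epsilon>. 0 < \<epsilon> \<and> \<epsilon> < 1) (at_right (0 :: real))"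
    using eventually_at_right_real[of 0 1] by simp
  show ?thesis
    using action_level_bounds(1)[OF _ p2 \<omega>, where 'n='n] bound
    by (intro tendsto_sandwich[OF _ _ tendsto_const lim] eventually_mono[OF ev]) auto
qed

theorem theorem1p2:
  fixes p \<omega> :: real
  assumes "CARD('n::finite) \<ge> 3"
    and "p > 2 * real CARD('n) / (real CARD('n) - 2)"
    and "\<omega> > 0"
  shows "((\<lambda>\<epsilon>. \<epsilon> ^ (CARD('n) - 1) * action_level TYPE('n) p \<omega> \<epsilon>) \<longlongrightarrow> 0) (at_right 0)
    \<and> (\<forall>u :: real \<Rightarrow> real ^ 'n \<Rightarrow> real.
          (\<forall>\<epsilon>>0. ground_state p \<omega> \<epsilon> (u \<epsilon>) \<and> (\<forall>x\<in>lattice \<epsilon>. u \<epsilon> x > 0)) \<longrightarrow>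
          (\<forall>\<epsilon>>0. interpolation \<epsilon> (u \<epsilon>) \<in> H1) \<and>
          ((\<lambda>\<epsilon>. H1_norm (interpolation \<epsilon> (u \<epsilon>))) \<longlongrightarrow> 0) (at_right 0))"
proof (intro conjI allI impI)
  show level: "((\<lambda>\<epsilon>. \<epsilon> ^ (CARD('n) - 1) * action_level TYPE('n) p \<omega> \<epsilon>) \<longlongrightarrow> 0) (at_right 0)"
    by (rule scaled_action_level_tendsto_0[OF assms])
  fix u :: "real \<Rightarrow> real ^ 'n \<Rightarrow> real"
  assume "\<forall>\<epsilon>>0. ground_state p \<omega> \<epsilon> (u \<epsilon>) \<and> (\<forall>x\<in>lattice \<epsilon>. u \<epsilon> x > 0)"
  then have gs: "u \<epsilon> \<in> nehari p \<omega> \<epsilon>" "action p \<omega> \<epsilon> (u \<epsilon>) = action_level TYPE('n) p \<omega> \<epsilon>" if "\<epsilon> > 0" for \<epsilon>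
    using that by (auto simp: ground_state_def)
  then have u_H1: "u \<epsilon> \<in> H1_lattice \<epsilon>" if "\<epsilon> > 0" for \<epsilon>
    using that by (auto simp: nehari_def)
  show "interpolation \<epsilon> (u \<epsilon>) \<in> H1" if "\<epsilon> > 0" for \<epsilon>
    by (rule interpolation_H1_bound(1)[OF that u_H1[OF that]])
  have p2: "p > 2" by (rule supercritical_gt_2[OF assms(1,2)])
  define a where "a = 1 / 2 - 1 / p"
  have a: "a > 0" using p2 by (simp add: a_def field_simps)
  \<comment> \<open>The factors are the number of cube corners from the Sobolev estimate, a common
    bound for the coefficients 2 and \<open>1 / \<omega>\<close> of the two quadratic terms, and the
    conversion \<open>1 / a\<close> from action to quadratic part.\<close>
  define C where "C = real (card {e :: int ^ 'n. \<forall>i. e $ i \<in> {0, 1}}) * (2 + 1 / \<omega>) / a"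
  define level where "level \<epsilon> = \<epsilon> ^ (CARD('n) - 1) * action_level TYPE('n) p \<omega> \<epsilon>" for \<epsilon>
  have bound: "H1_norm (interpolation \<epsilon> (u \<epsilon>)) \<le> sqrt (C * level \<epsilon>)" if \<epsilon>: "\<epsilon> > 0" for \<epsilon>
  proof -
    define X where "X = (grad_norm \<epsilon> (u \<epsilon>))\<^sup>2"
    define Y where "Y = (lq_norm \<epsilon> 2 (u \<epsilon>))\<^sup>2"
    define m where "m = \<epsilon> ^ (CARD('n) - 1)"
    have XY: "0 \<le> X" "0 \<le> Y" "0 \<le> m" using \<epsilon> by (simp_all add: X_def Y_def m_def)
    have "\<epsilon> ^ CARD('n) = \<epsilon> * m" by (simp add: m_def power_eq_if)
    then have "2 * \<epsilon> ^ (CARD('n) - 1) * X + \<epsilon> ^ CARD('n) * Y = m * (2 * X + 1 / \<omega> * (\<epsilon> * \<omega> * Y))"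
      using assms(3) by (simp add: m_def algebra_simps)
    \<comment> \<open>Both quadratic terms are nonnegative, so their coefficients may be raised to a
      common value. This recreates the quadratic part of the Nehari identity, which the ground state
      equates with a multiple of the level.\<close>
    also have "\<dots> \<le> m * ((2 + 1 / \<omega>) * (X + \<epsilon> * \<omega> * Y))"
      using XY \<epsilon> assms(3) by (intro mult_left_mono) (auto simp: distrib_left distrib_right)
    also have "X + \<epsilon> * \<omega> * Y = action_level TYPE('n) p \<omega> \<epsilon> / a"
      using action_nehari(1)[OF gs(1)[OF \<epsilon>]] gs(2)[OF \<epsilon>] a by (simp add: X_def Y_def a_def[symmetric])
    finally have le: "2 * \<epsilon> ^ (CARD('n) - 1) * X + \<epsilon> ^ CARD('n) * Y
        \<le> m * ((2 + 1 / \<omega>) * (action_level TYPE('n) p \<omega> \<epsilon> / a))" .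
    have "(H1_norm (interpolation \<epsilon> (u \<epsilon>)))\<^sup>2 \<le> real (card {e :: int ^ 'n. \<forall>i. e $ i \<in> {0, 1}}) *
        (2 * \<epsilon> ^ (CARD('n) - 1) * X + \<epsilon> ^ CARD('n) * Y)"
      unfolding X_def Y_def by (rule interpolation_H1_bound(3)[OF \<epsilon> u_H1[OF \<epsilon>]])
    also have "\<dots> \<le> real (card {e :: int ^ 'n. \<forall>i. e $ i \<in> {0, 1}}) *
        (m * ((2 + 1 / \<omega>) * (action_level TYPE('n) p \<omega> \<epsilon> / a)))"
      by (rule mult_left_mono[OF le]) simp
    also have "\<dots> = C * level \<epsilon>" by (simp add: C_def level_def m_def)
    finally show ?thesis by (rule real_le_rsqrt)
  qed
  have "((\<lambda>\<epsilon>. sqrt (C * level \<epsilon>)) \<longlongrightarrow> sqrt (C * 0)) (at_right 0)"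
    using level unfolding level_def by (intro tendsto_intros)
  then have lim: "((\<lambda>\<epsilon>. sqrt (C * level \<epsilon>)) \<longlongrightarrow> 0) (at_right 0)" by simp
  show "((\<lambda>\<epsilon>. H1_norm (interpolation \<epsilon> (u \<epsilon>))) \<longlongrightarrow> 0) (at_right 0)"
    using interpolation_H1_bound(2) u_H1 bound
    by (intro tendsto_sandwich[OF _ _ tendsto_const lim] eventually_mono[OF eventually_at_right_less]) auto
qed

end
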